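(* Let $(L,\alpha_L)$ be any Hom-Lie algebra over $\mathbb F$. Then there is an isomorphism of Hom-vector spaces $H_2^\alpha(L)\cong(\ker(\lambda_L),\alpha_{\ker(\lambda_L)})$, where $\lambda_L:(L\curlywedge L,\alpha_{\curlywedge})\to(L,\alpha_L)$, $l_1\curlywedge l_2\mapsto[l_1,l_2]$, is the commutator map and $\alpha_{\ker(\lambda_L)}$ is the restriction of $\alpha_\curlywedge$.
   Context: Fix a field $\mathbb F$. A Hom-vector space is a pair $(V,\alpha_V)$ of an $\mathbb F$-vector space and a linear map $\alpha_V:V\to V$; morphisms are linear maps commuting with these maps. A (multiplicative) Hom-Lie algebra $(L,\alpha_L)$ is a Hom-vector space with a bilinear product $[\,,]$ such that $[x,y]=-[y,x]$, $[\alpha_L(x),[y,z]]+[\alpha_L(y),[z,x]]+[\alpha_L(z),[x,y]]=0$ and $\alpha_L([x,y])=[\alpha_L(x),\alpha_L(y)]$. Homomorphisms are algebra homomorphisms commuting with the structure maps. Exterior product: $(L\star L,\alpha_\star)$ is the Hom-Lie algebra generated by symbols $l\star l'$ ($l,l'\in L$), bilinear in $l,l'$ over $\mathbb F$, subject to $[m,m']\star\alpha_L(n)=\alpha_L(m)\star[m',n]-\alpha_L(m')\star[m,n]$, $\ \alpha_L(m)\star[n,n']=[n',m]\star\alpha_L(n)-[n,m]\star\alpha_L(n')$, $\ [m\star n,m'\star n']=-[n,m]\star[m',n']$, for all $m,m',n,n'\in L$, with $\alpha_\star(m\star n)=\alpha_L(m)\star\alpha_L(n)$. Let $L\square L$ be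 the subspace spanned by all $x\star x$, $x\in L$ (it is a central ideal). Then $(L\curlywedge L,\alpha_\curlywedge)=(L\star L)/(L\square L)$ with the induced map, and $m\curlywedge n$ is the image of $m\star n$. Homology (trivial coefficients): let $C_n^\alpha(L)=L^{\wedge n}$ (exterior power, $L^{\wedge 0}=\mathbb F$) with map $\alpha_L^{\wedge n}$, and $d_n:C_n^\alpha(L)\to C_{n-1}^\alpha(L)$, $d_n(x_1\wedge\dots\wedge x_n)=\sum_{i<j}(-1)^{i+j}[x_i,x_j]\wedge\alpha_L(x_1)\wedge\dots\wedge\widehat{\alpha_L(x_i)}\wedge\dots\wedge\widehat{\alpha_L(x_j)}\wedge\dots\wedge\alpha_L(x_n)$. Then $H_n^\alpha(L)=\ker(d_n)/\mathrm{Im}(d_{n+1})$, with the map induced by $\alpha_L^{\wedge n}$.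
   Formalization: In characteristic 2 it is additionally assumed that [x,x]=0 for all x in L; otherwise the commutator map is not well defined on L⋏L, because x⋏x=0 would have to map to [x,x]≠0. In other characteristics this is automatic. *)

theory Defs
  imports Complex_Main "HOL-Library.FuncSet" "HOL-Library.Poly_Mapping"
begin

section \<open>Hom-vector spaces\<close>

text \<open>
  The objects in question are iterated quotients depending on the algebra \<open>L\<close>, so they are
  represented with explicit carriers; the scalars form a type of class \<open>field\<close>.
\<close>

record ('k, 'a) hom_space =
  carrier :: "'a set"
  zero :: 'a
  add :: "'a \<Rightarrow> 'a \<Rightarrow> 'a"
  scl :: "'k \<Rightarrow> 'a \<Rightarrow> 'a"
  twist :: "'a \<Rightarrow> 'a"

record ('k, 'a) hom_algebra = "('k, 'a) hom_space" +
  bracket :: "'a \<Rightarrow> 'a \<Rightarrow> 'a"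

locale hom_vector_space =
  fixes V :: "('k::field, 'a, 'm) hom_space_scheme"
  assumes zero_closed: "zero V \<in> carrier V"
    and add_closed: "\<lbrakk>x \<in> carrier V; y \<in> carrier V\<rbrakk> \<Longrightarrow> add V x y \<in> carrier V"
    and scl_closed: "x \<in> carrier V \<Longrightarrow> scl V c x \<in> carrier V"
    and twist_closed: "x \<in> carrier V \<Longrightarrow> twist V x \<in> carrier V"
    and add_assoc: "\<lbrakk>x \<in> carrier V; y \<in> carrier V; z \<in> carrier V\<rbrakk>
          \<Longrightarrow> add V (add V x y) z = add V x (add V y z)"
    and add_comm: "\<lbrakk>x \<in> carrier V; y \<in> carrier V\<rbrakk> \<Longrightarrow> add V x y = add V y x"
    and add_zero: "x \<in> carrier V \<Longrightarrow> add V (zero V) x = x"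
    and add_inverse: "x \<in> carrier V \<Longrightarrow> \<exists>y\<in>carrier V. add V x y = zero V"
    and scl_add: "\<lbrakk>x \<in> carrier V; y \<in> carrier V\<rbrakk>
          \<Longrightarrow> scl V c (add V x y) = add V (scl V c x) (scl V c y)"
    and add_scl: "x \<in> carrier V \<Longrightarrow> scl V (c + d) x = add V (scl V c x) (scl V d x)"
    and scl_scl: "x \<in> carrier V \<Longrightarrow> scl V c (scl V d x) = scl V (c * d) x"
    and scl_one: "x \<in> carrier V \<Longrightarrow> scl V 1 x = x"
    and twist_add: "\<lbrakk>x \<in> carrier V; y \<in> carrier V\<rbrakk>
          \<Longrightarrow> twist V (add V x y) = add V (twist V x) (twist V y)"
    and twist_scl: "x \<in> carrier V \<Longrightarrow> twist V (scl V c x) = scl V c (twist V x)"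

definition space_hom ::
    "('k, 'a, 'm) hom_space_scheme \<Rightarrow> ('k, 'b, 'n) hom_space_scheme \<Rightarrow> ('a \<Rightarrow> 'b) set" where
  "space_hom V W = {f \<in> carrier V \<rightarrow> carrier W.
     (\<forall>x\<in>carrier V. \<forall>y\<in>carrier V. f (add V x y) = add W (f x) (f y)) \<and>
     (\<forall>c. \<forall>x\<in>carrier V. f (scl V c x) = scl W c (f x)) \<and>
     (\<forall>x\<in>carrier V. f (twist V x) = twist W (f x))}"

definition space_isomorphic ::
    "('k::field, 'a, 'm) hom_space_scheme \<Rightarrow> ('k, 'b, 'n) hom_space_scheme \<Rightarrow> bool" where
  "space_isomorphic V W \<longleftrightarrow> hom_vector_space V \<and> hom_vector_space W \<and>
     (\<exists>f\<in>space_hom V W. bij_betw f (carrier V) (carrier W))"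

definition algebra_hom ::
    "('k, 'a, 'm) hom_algebra_scheme \<Rightarrow> ('k, 'b, 'n) hom_algebra_scheme \<Rightarrow> ('a \<Rightarrow> 'b) set" where
  "algebra_hom A B = {f \<in> space_hom A B.
     \<forall>x\<in>carrier A. \<forall>y\<in>carrier A. f (bracket A x y) = bracket B (f x) (f y)}"

definition linear_subspace :: "('k, 'a, 'm) hom_space_scheme \<Rightarrow> 'a set \<Rightarrow> bool" where
  "linear_subspace V U \<longleftrightarrow> U \<subseteq> carrier V \<and> zero V \<in> U \<and>
     (\<forall>x\<in>U. \<forall>y\<in>U. add V x y \<in> U) \<and> (\<forall>c. \<forall>x\<in>U. scl V c x \<in> U)"

definition linear_span :: "('k, 'a, 'm) hom_space_scheme \<Rightarrow> 'a set \<Rightarrow> 'a set" where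
  "linear_span V S = \<Inter>{U. linear_subspace V U \<and> S \<subseteq> U}"

definition kernel ::
    "('k, 'a, 'm) hom_space_scheme \<Rightarrow> ('k, 'b, 'n) hom_space_scheme \<Rightarrow> ('a \<Rightarrow> 'b) \<Rightarrow> 'a set" where
  "kernel V W f = {x \<in> carrier V. f x = zero W}"

definition restrict_space ::
    "('k, 'a, 'm) hom_space_scheme \<Rightarrow> 'a set \<Rightarrow> ('k, 'a) hom_space" where
  "restrict_space V U =
     \<lparr>carrier = U, zero = zero V, add = add V, scl = scl V, twist = twist V\<rparr>"

definition coset :: "('k, 'a, 'm) hom_space_scheme \<Rightarrow> 'a set \<Rightarrow> 'a \<Rightarrow> 'a set" where
  "coset V U x = {add V x u | u. u \<in> U}"

text \<open>
  The operations of a quotient apply the operation to all representatives and take the union of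
  the resulting cosets, which is a single coset whenever the operation is well defined.
\<close>

definition quotient_space ::
    "('k, 'a, 'm) hom_space_scheme \<Rightarrow> 'a set \<Rightarrow> ('k, 'a set) hom_space" where
  "quotient_space V U =
     \<lparr>carrier = coset V U ` carrier V,
      zero = coset V U (zero V),
      add = (\<lambda>X Y. \<Union>x\<in>X. \<Union>y\<in>Y. coset V U (add V x y)),
      scl = (\<lambda>c X. \<Union>x\<in>X. coset V U (scl V c x)),
      twist = (\<lambda>X. \<Union>x\<in>X. coset V U (twist V x))\<rparr>"

definition quotient_algebra ::
    "('k, 'a, 'm) hom_algebra_scheme \<Rightarrow> 'a set \<Rightarrow> ('k, 'a set) hom_algebra" where
  "quotient_algebra A I = hom_space.extend (quotient_space A I)
     (hom_algebra.fields (\<lambda>X Y. \<Union>x\<in>X. \<Union>y\<in>Y. coset A I (bracket A x y)))"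


section \<open>Hom-Lie algebras by generators and relations\<close>

datatype ('k, 'g) hom_term =
    Gen 'g
  | Zero
  | Add "('k, 'g) hom_term" "('k, 'g) hom_term"
  | Scale 'k "('k, 'g) hom_term"
  | Twist "('k, 'g) hom_term"
  | Bracket "('k, 'g) hom_term" "('k, 'g) hom_term"

text \<open>The least congruence containing \<open>R\<close> and all instances of the axioms of Hom-Lie algebras.\<close>

inductive hom_lie_cong ::
    "(('k::field, 'g) hom_term \<times> ('k, 'g) hom_term) set \<Rightarrow>
      ('k, 'g) hom_term \<Rightarrow> ('k, 'g) hom_term \<Rightarrow> bool"
  for R where
    rel: "(s, t) \<in> R \<Longrightarrow> hom_lie_cong R s t"
  | refl: "hom_lie_cong R t t"
  | sym: "hom_lie_cong R s t \<Longrightarrow> hom_lie_cong R t s"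
  | trans: "\<lbrakk>hom_lie_cong R s t; hom_lie_cong R t u\<rbrakk> \<Longrightarrow> hom_lie_cong R s u"
  | cong_add: "\<lbrakk>hom_lie_cong R s s'; hom_lie_cong R t t'\<rbrakk> \<Longrightarrow> hom_lie_cong R (Add s t) (Add s' t')"
  | cong_scale: "hom_lie_cong R t t' \<Longrightarrow> hom_lie_cong R (Scale c t) (Scale c t')"
  | cong_twist: "hom_lie_cong R t t' \<Longrightarrow> hom_lie_cong R (Twist t) (Twist t')"
  | cong_bracket: "\<lbrakk>hom_lie_cong R s s'; hom_lie_cong R t t'\<rbrakk>
      \<Longrightarrow> hom_lie_cong R (Bracket s t) (Bracket s' t')"
  | add_assoc: "hom_lie_cong R (Add (Add s t) u) (Add s (Add t u))"
  | add_comm: "hom_lie_cong R (Add s t) (Add t s)"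
  | add_zero: "hom_lie_cong R (Add Zero t) t"
  | add_inverse: "hom_lie_cong R (Add t (Scale (- 1) t)) Zero"
  | scale_add: "hom_lie_cong R (Scale c (Add s t)) (Add (Scale c s) (Scale c t))"
  | add_scale: "hom_lie_cong R (Scale (c + d) t) (Add (Scale c t) (Scale d t))"
  | scale_scale: "hom_lie_cong R (Scale c (Scale d t)) (Scale (c * d) t)"
  | scale_one: "hom_lie_cong R (Scale 1 t) t"
  | twist_add: "hom_lie_cong R (Twist (Add s t)) (Add (Twist s) (Twist t))"
  | twist_scale: "hom_lie_cong R (Twist (Scale c t)) (Scale c (Twist t))"
  | bracket_add_left: "hom_lie_cong R (Bracket (Add s t) u) (Add (Bracket s u) (Bracket t u))"
  | bracket_add_right: "hom_lie_cong R (Bracket s (Add t u)) (Add (Bracket s t) (Bracket s u))"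
  | bracket_scale_left: "hom_lie_cong R (Bracket (Scale c s) t) (Scale c (Bracket s t))"
  | bracket_scale_right: "hom_lie_cong R (Bracket s (Scale c t)) (Scale c (Bracket s t))"
  | skew: "hom_lie_cong R (Bracket s t) (Scale (- 1) (Bracket t s))"
  | hom_jacobi: "hom_lie_cong R
      (Add (Bracket (Twist s) (Bracket t u))
        (Add (Bracket (Twist t) (Bracket u s)) (Bracket (Twist u) (Bracket s t)))) Zero"
  | twist_bracket: "hom_lie_cong R (Twist (Bracket s t)) (Bracket (Twist s) (Twist t))"

definition term_class ::
    "(('k::field, 'g) hom_term \<times> ('k, 'g) hom_term) set \<Rightarrow>
      ('k, 'g) hom_term \<Rightarrow> ('k, 'g) hom_term set" where
  "term_class R t = {s. hom_lie_cong R t s}"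

definition presented_hom_lie ::
    "(('k::field, 'g) hom_term \<times> ('k, 'g) hom_term) set \<Rightarrow>
      ('k, ('k, 'g) hom_term set) hom_algebra" where
  "presented_hom_lie R =
     \<lparr>carrier = range (term_class R),
      zero = term_class R Zero,
      add = (\<lambda>X Y. \<Union>s\<in>X. \<Union>t\<in>Y. term_class R (Add s t)),
      scl = (\<lambda>c X. \<Union>t\<in>X. term_class R (Scale c t)),
      twist = (\<lambda>X. \<Union>t\<in>X. term_class R (Twist t)),
      bracket = (\<lambda>X Y. \<Union>s\<in>X. \<Union>t\<in>Y. term_class R (Bracket s t))\<rparr>"


section \<open>Free vector spaces\<close>

definition fscale :: "'k::field \<Rightarrow> ('x \<Rightarrow>\<^sub>0 'k) \<Rightarrow> ('x \<Rightarrow>\<^sub>0 'k)" where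
  "fscale c f = Poly_Mapping.map ((*) c) f"

definition basis :: "'x \<Rightarrow> ('x \<Rightarrow>\<^sub>0 'k::field)" where
  "basis x = Poly_Mapping.single x 1"

definition linear_extension ::
    "('x \<Rightarrow> ('y \<Rightarrow>\<^sub>0 'k::field)) \<Rightarrow> ('x \<Rightarrow>\<^sub>0 'k) \<Rightarrow> ('y \<Rightarrow>\<^sub>0 'k)" where
  "linear_extension g f = (\<Sum>x\<in>Poly_Mapping.keys f. fscale (Poly_Mapping.lookup f x) (g x))"

definition free_space :: "'x set \<Rightarrow> ('x \<Rightarrow> 'x) \<Rightarrow> ('k::field, 'x \<Rightarrow>\<^sub>0 'k) hom_space" where
  "free_space S \<phi> =
     \<lparr>carrier = {f. Poly_Mapping.keys f \<subseteq> S}, zero = 0, add = (+), scl = fscale,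
      twist = linear_extension (\<lambda>x. basis (\<phi> x))\<rparr>"


section \<open>Hom-Lie algebras\<close>

locale hom_lie_algebra = vector_space scale
  for scale :: "'k::field \<Rightarrow> 'v::ab_group_add \<Rightarrow> 'v" (infixr \<open>*s\<close> 75) +
  fixes \<alpha> :: "'v \<Rightarrow> 'v" and br :: "'v \<Rightarrow> 'v \<Rightarrow> 'v"
  assumes \<alpha>_linear: "Vector_Spaces.linear scale scale \<alpha>"
    and br_linear_left: "Vector_Spaces.linear scale scale (\<lambda>x. br x y)"
    and br_linear_right: "Vector_Spaces.linear scale scale (\<lambda>y. br x y)"
    and br_skew: "br x y = - br y x"
    and br_hom_jacobi: "br (\<alpha> x) (br y z) + br (\<alpha> y) (br z x) + br (\<alpha> z) (br x y) = 0"
    and \<alpha>_br: "\<alpha> (br x y) = br (\<alpha> x) (\<alpha> y)"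
begin

definition self_algebra :: "('k, 'v) hom_algebra" where
  "self_algebra =
     \<lparr>carrier = UNIV, zero = 0, add = (+), scl = scale, twist = \<alpha>, bracket = br\<rparr>"

subsection \<open>The exterior product\<close>

abbreviation gen :: "'v \<Rightarrow> 'v \<Rightarrow> ('k, 'v \<times> 'v) hom_term" (infix \<open>\<star>\<close> 90) where
  "m \<star> n \<equiv> Gen (m, n)"

abbreviation minus_term ::
    "('k, 'v \<times> 'v) hom_term \<Rightarrow> ('k, 'v \<times> 'v) hom_term \<Rightarrow> ('k, 'v \<times> 'v) hom_term"
    (infixl \<open>\<ominus>\<close> 65) where
  "s \<ominus> t \<equiv> Add s (Scale (- 1) t)"

inductive_set star_relations :: "(('k, 'v \<times> 'v) hom_term \<times> ('k, 'v \<times> 'v) hom_term) set" where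
    star_add_left: "((m + m') \<star> n, Add (m \<star> n) (m' \<star> n)) \<in> star_relations"
  | star_add_right: "(m \<star> (n + n'), Add (m \<star> n) (m \<star> n')) \<in> star_relations"
  | star_scale_left: "((c *s m) \<star> n, Scale c (m \<star> n)) \<in> star_relations"
  | star_scale_right: "(m \<star> (c *s n), Scale c (m \<star> n)) \<in> star_relations"
  | star_br_left: "(br m m' \<star> \<alpha> n, \<alpha> m \<star> br m' n \<ominus> \<alpha> m' \<star> br m n) \<in> star_relations"
  | star_br_right: "(\<alpha> m \<star> br n n', br n' m \<star> \<alpha> n \<ominus> br n m \<star> \<alpha> n') \<in> star_relations"
  | star_bracket: "(Bracket (m \<star> n) (m' \<star> n'), Scale (- 1) (br n m \<star> br m' n')) \<in> star_relations"
  | star_twist: "(Twist (m \<star> n), \<alpha> m \<star> \<alpha> n) \<in> star_relations"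

definition star_product :: "('k, ('k, 'v \<times> 'v) hom_term set) hom_algebra" where
  "star_product = presented_hom_lie star_relations"

definition star :: "'v \<Rightarrow> 'v \<Rightarrow> ('k, 'v \<times> 'v) hom_term set" where
  "star m n = term_class star_relations (m \<star> n)"

definition box_ideal :: "('k, 'v \<times> 'v) hom_term set set" where
  "box_ideal = linear_span star_product {star x x | x. True}"

definition curly_product :: "('k, ('k, 'v \<times> 'v) hom_term set set) hom_algebra" where
  "curly_product = quotient_algebra star_product box_ideal"

definition curly :: "'v \<Rightarrow> 'v \<Rightarrow> ('k, 'v \<times> 'v) hom_term set set" where
  "curly m n = coset star_product box_ideal (star m n)"

definition commutator_map :: "('k, 'v \<times> 'v) hom_term set set \<Rightarrow> 'v" where
  "commutator_map = (THE f. f \<in> algebra_hom curly_product self_algebra \<and>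
     f \<in> extensional (carrier curly_product) \<and> (\<forall>m n. f (curly m n) = br m n))"

definition commutator_kernel :: "('k, ('k, 'v \<times> 'v) hom_term set set) hom_space" where
  "commutator_kernel =
     restrict_space curly_product (kernel curly_product self_algebra commutator_map)"

subsection \<open>Homology with trivial coefficients\<close>

text \<open>
  \<open>L\<^sup>\<and>\<^sup>n\<close> is the free vector space on \<open>n\<close>-tuples modulo multilinearity and the
  alternating relations.
\<close>

definition tuple_space :: "nat \<Rightarrow> ('k, 'v list \<Rightarrow>\<^sub>0 'k) hom_space" where
  "tuple_space n = free_space {xs. length xs = n} (map \<alpha>)"

inductive_set exterior_relations :: "nat \<Rightarrow> ('v list \<Rightarrow>\<^sub>0 'k) set" for n where
    multi_add: "\<lbrakk>length xs = n; i < n\<rbrakk> \<Longrightarrow>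
      basis (xs[i := x + y]) - basis (xs[i := x]) - basis (xs[i := y]) \<in> exterior_relations n"
  | multi_scale: "\<lbrakk>length xs = n; i < n\<rbrakk> \<Longrightarrow>
      basis (xs[i := c *s x]) - fscale c (basis (xs[i := x])) \<in> exterior_relations n"
  | alternating: "\<lbrakk>length xs = n; i < j; j < n; xs ! i = xs ! j\<rbrakk> \<Longrightarrow>
      basis xs \<in> exterior_relations n"

definition exterior_kernel :: "nat \<Rightarrow> ('v list \<Rightarrow>\<^sub>0 'k) set" where
  "exterior_kernel n = linear_span (tuple_space n) (exterior_relations n)"

definition exterior_power :: "nat \<Rightarrow> ('k, ('v list \<Rightarrow>\<^sub>0 'k) set) hom_space" where
  "exterior_power n = quotient_space (tuple_space n) (exterior_kernel n)"

text \<open>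
  Indices start at \<open>0\<close> here, which leaves the sign \<open>(- 1) ^ (i + j)\<close> unchanged;
  \<^term>\<open>nths xs (- {i, j})\<close> omits the entries \<open>i\<close> and \<open>j\<close>.
\<close>

definition boundary_tuple :: "'v list \<Rightarrow> ('v list \<Rightarrow>\<^sub>0 'k)" where
  "boundary_tuple xs = (\<Sum>j<length xs. \<Sum>i<j.
     fscale ((- 1) ^ (i + j)) (basis (br (xs ! i) (xs ! j) # map \<alpha> (nths xs (- {i, j})))))"

text \<open>\<open>boundary n\<close> is \<open>d\<^sub>n\<close> for \<open>n \<ge> 1\<close>; for \<open>n = 0\<close> it is the zero map.\<close>

definition boundary :: "nat \<Rightarrow> ('v list \<Rightarrow>\<^sub>0 'k) set \<Rightarrow> ('v list \<Rightarrow>\<^sub>0 'k) set" where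
  "boundary n X = (\<Union>f\<in>X. coset (tuple_space (n - 1)) (exterior_kernel (n - 1))
     (linear_extension boundary_tuple f))"

definition cycles :: "nat \<Rightarrow> ('v list \<Rightarrow>\<^sub>0 'k) set set" where
  "cycles n = kernel (exterior_power n) (exterior_power (n - 1)) (boundary n)"

definition boundaries :: "nat \<Rightarrow> ('v list \<Rightarrow>\<^sub>0 'k) set set" where
  "boundaries n = boundary (n + 1) ` carrier (exterior_power (n + 1))"

definition homology :: "nat \<Rightarrow> ('k, ('v list \<Rightarrow>\<^sub>0 'k) set set) hom_space" where
  "homology n = quotient_space (restrict_space (exterior_power n) (cycles n)) (boundaries n)"

text \<open>
  In characteristic \<open>2\<close> skew-symmetry does not give \<open>[x, x] = 0\<close>, without which neither
  \<open>d\<^sub>2\<close> nor the commutator map is well defined.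
\<close>

lemma br_self:
  assumes "(2 :: 'k) \<noteq> 0"
  shows "br x x = 0"
proof -
  have "(2 :: 'k) *s br x x = br x x + br x x"
    using scale_left_distrib[of 1 1 "br x x"] by simp
  also have "\<dots> = 0"
    using br_skew[of x x] by (metis add.right_inverse)
  finally show ?thesis
    using assms by simp
qed

end

end

theory Submission
  imports "HOL-Algebra.FiniteProduct" Defs
begin

text \<open>
  The relation for brackets of generators makes \<open>L \<star> L\<close> the linear span of the \<open>m \<star> n\<close>, and modulo
  \<open>x \<star> x\<close> the two remaining relations both say that \<open>d\<^sub>3\<close>-boundaries vanish. Hence the free space on
  pairs maps onto \<open>L \<curlywedge> L\<close> with kernel the preimage of \<open>Im d\<^sub>3\<close>. That the kernel is no larger is seen by
  making \<open>L\<^sup>\<and>\<^sup>2 / Im d\<^sub>3\<close> a Hom-Lie algebra with \<open>[u, v] = \<lambda> u \<and> \<lambda> v\<close>, in which all relations hold. Since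
  \<open>d\<^sub>2\<close> is minus the commutator map, \<open>H\<^sub>2\<close> and \<open>ker \<lambda>\<close> are quotients of one subspace by one kernel.
\<close>

section \<open>Hom-vector spaces\<close>

text \<open>Both sides are iterated quotients, one of them by a congruence on syntactic terms, so a
  direct map between them would need a well-definedness argument at every layer. All computation is
  therefore done on representatives in the free space on pairs, and the isomorphism is read off from
  two surjections with the same source and the same kernel \<open>bounding\<close>. The Hom-Lie
  structure on \<open>L\<^sup>\<and>\<^sup>2 / Im d\<^sub>3\<close> is never formed as an object
  either: \<open>term_value\<close> evaluates a term to a representative, and rule induction over
  the congruence shows that congruent terms have equal values modulo \<open>bounding\<close>. The
  delicate point is that the bracket of two values depends only on their classes. It does because
  \<open>pair_br\<close> vanishes on \<open>bounding\<close>, which says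
  \<open>d\<^sub>2 d\<^sub>3 = 0\<close> and comes from the Hom-Jacobi identity of
  \<open>L\<close>.\<close>

definition additive_group ::
    "('k, 'a, 'm) hom_space_scheme \<Rightarrow> 'a monoid" where
  "additive_group V = \<lparr>partial_object.carrier = carrier V, mult = add V, one = zero V\<rparr>"

lemma additive_group_simps [simp]:
  "partial_object.carrier (additive_group V) = carrier V"
  "mult (additive_group V) = add V"
  "one (additive_group V) = zero V"
  by (simp_all add: additive_group_def)

lemma linear_subspaceD:
  assumes "linear_subspace V U"
  shows "U \<subseteq> carrier V" "zero V \<in> U"
    and "\<lbrakk>x \<in> U; y \<in> U\<rbrakk> \<Longrightarrow> add V x y \<in> U" "x \<in> U \<Longrightarrow> scl V c x \<in> U"
  using assms by (auto simp: linear_subspace_def)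

lemma linear_span_least: "\<lbrakk>linear_subspace V U; S \<subseteq> U\<rbrakk> \<Longrightarrow> linear_span V S \<subseteq> U"
  by (auto simp: linear_span_def)

lemma linear_span_base: "x \<in> S \<Longrightarrow> x \<in> linear_span V S"
  by (auto simp: linear_span_def)

lemma space_homD:
  assumes "f \<in> space_hom V W" "x \<in> carrier V"
  shows "f x \<in> carrier W" "y \<in> carrier V \<Longrightarrow> f (add V x y) = add W (f x) (f y)"
    "f (scl V c x) = scl W c (f x)" "f (twist V x) = twist W (f x)"
  using assms by (auto simp: space_hom_def)

lemma space_hom_compose:
  "\<lbrakk>f \<in> space_hom V W; g \<in> space_hom W X\<rbrakk> \<Longrightarrow> g \<circ> f \<in> space_hom V X"
  by (auto simp: space_hom_def Pi_iff)

context hom_vector_space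
begin

text \<open>Gives access to the cancellation laws of groups and to \<open>finprod\<close>, with
  which linear combinations are formed in a space that is only a carrier inside a type.\<close>

lemma comm_group_additive_group: "comm_group (additive_group V)"
proof (rule comm_groupI)
  fix x assume "x \<in> partial_object.carrier (additive_group V)"
  then show "\<exists>y\<in>partial_object.carrier (additive_group V).
      y \<otimes>\<^bsub>additive_group V\<^esub> x = \<one>\<^bsub>additive_group V\<^esub>"
    using add_inverse[of x] add_comm[of x] by auto
qed (auto simp: zero_closed add_closed add_assoc add_zero intro: add_comm)

sublocale additive: comm_group "additive_group V"
  by (rule comm_group_additive_group)

lemma scl_0: "x \<in> carrier V \<Longrightarrow> scl V 0 x = zero V"
  using add_scl[of x 0 0] additive.r_cancel_one[of "scl V 0 x" "scl V 0 x"] scl_closed[of x 0]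
  by simp

lemma scl_zero: "scl V c (zero V) = zero V"
  using scl_scl[OF zero_closed, of c 0] by (simp add: scl_0 zero_closed)

lemma twist_zero: "twist V (zero V) = zero V"
  using twist_scl[OF zero_closed, of 0] by (simp add: scl_0 zero_closed twist_closed)

text \<open>The records carry no subtraction; \<open>scl V (- 1)\<close> plays the role of negation
  from here on.\<close>

lemma add_minus: "x \<in> carrier V \<Longrightarrow> add V x (scl V (- 1) x) = zero V"
  using add_scl[of x 1 "- 1"] by (simp add: scl_0 scl_one)

lemma add_zero_right: "x \<in> carrier V \<Longrightarrow> add V x (zero V) = x"
  using add_zero add_comm zero_closed by metis

lemma add_left_comm:
  "\<lbrakk>x \<in> carrier V; y \<in> carrier V; z \<in> carrier V\<rbrakk> \<Longrightarrow> add V x (add V y z) = add V y (add V x z)"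
  using additive.m_lcomm by simp

lemma add_minus_cancel:
  "\<lbrakk>x \<in> carrier V; y \<in> carrier V\<rbrakk> \<Longrightarrow> add V y (add V x (scl V (- 1) y)) = x"
  by (simp add: add_left_comm[of y x] add_minus scl_closed add_zero_right)

lemma eq_if_diff_zero:
  assumes "x \<in> carrier V" "y \<in> carrier V" "add V x (scl V (- 1) y) = zero V"
  shows "x = y"
  using add_minus_cancel[OF assms(1,2)] assms by (simp add: add_zero_right)

lemma linear_subspace_carrier: "linear_subspace V (carrier V)"
  by (auto simp: linear_subspace_def zero_closed add_closed scl_closed)

lemma linear_span_subspace:
  assumes "S \<subseteq> carrier V"
  shows "linear_subspace V (linear_span V S)"
  using assms linear_subspace_carrier by (auto simp: linear_subspace_def linear_span_def)

lemma space_hom_zero: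
  assumes "hom_vector_space W" "f \<in> space_hom V W"
  shows "f (zero V) = zero W"
proof -
  interpret W: hom_vector_space W by fact
  have "f (scl V 0 (zero V)) = scl W 0 (f (zero V))"
    using assms(2) zero_closed by (rule space_homD)
  then show ?thesis
    using space_homD(1)[OF assms(2) zero_closed] by (simp add: scl_0 zero_closed W.scl_0)
qed

lemma kernel_subspace:
  assumes "hom_vector_space W" "f \<in> space_hom V W"
  shows "linear_subspace V (kernel V W f)"
proof -
  interpret W: hom_vector_space W by fact
  show ?thesis
    unfolding linear_subspace_def kernel_def
    using space_hom_zero[OF assms]
    by (auto simp: zero_closed add_closed scl_closed space_homD[OF assms(2)] W.add_zero
        W.zero_closed W.scl_zero)
qed

lemma image_subspace:
  assumes "hom_vector_space W" "f \<in> space_hom V W" "linear_subspace V U"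
  shows "linear_subspace W (f ` U)"
proof -
  have "u \<in> carrier V" if "u \<in> U" for u
    using linear_subspaceD(1)[OF assms(3)] that by auto
  then show ?thesis
    using linear_subspaceD(2-4)[OF assms(3)]
    unfolding linear_subspace_def space_hom_zero[OF assms(1,2), symmetric]
    by (auto simp: space_homD(1)[OF assms(2)] space_homD(2,3)[OF assms(2), symmetric])
qed

lemma space_hom_eq_iff:
  assumes "hom_vector_space W" and f: "f \<in> space_hom V W" and x: "x \<in> carrier V" "y \<in> carrier V"
  shows "f x = f y \<longleftrightarrow> f (add V x (scl V (- 1) y)) = zero W"
proof -
  interpret W: hom_vector_space W by fact
  have "f (add V x (scl V (- 1) y)) = add W (f x) (scl W (- 1) (f y))"
    using x by (simp add: space_homD[OF f] scl_closed)
  then show ?thesis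
    using x W.eq_if_diff_zero W.add_minus space_homD(1)[OF f] by metis
qed

text \<open>Only the operations of \<open>W\<close> are given here; its axioms are inherited from \<open>V\<close>.\<close>

lemma image_hom_vector_space:
  assumes f: "f \<in> space_hom V W" and surj: "f ` carrier V = carrier W" and z: "f (zero V) = zero W"
  shows "hom_vector_space W"
proof -
  note h = space_homD(2-4)[OF f, symmetric]
  note c = zero_closed add_closed scl_closed twist_closed
  have ex: "\<exists>x\<in>carrier V. y = f x" if "y \<in> carrier W" for y
    using that surj by auto
  show ?thesis
  proof
    fix x assume "x \<in> carrier W"
    then obtain a where "a \<in> carrier V" "x = f a" using ex by blast
    moreover obtain b where "b \<in> carrier V" "add V a b = zero V"
      using add_inverse \<open>a \<in> carrier V\<close> by blast
    ultimately show "\<exists>y\<in>carrier W. add W x y = zero W"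
      using surj z h(1) by (metis image_eqI)
  qed (use z in \<open>auto simp: h c surj[symmetric] z[symmetric] add_assoc add_zero scl_add add_scl
      scl_scl scl_one twist_add twist_scl intro: arg_cong[OF add_comm]\<close>)
qed

lemma restrict_hom_vector_space:
  assumes "linear_subspace V U" "\<And>x. x \<in> U \<Longrightarrow> twist V x \<in> U"
  shows "hom_vector_space (restrict_space V U)"
proof
  have U: "\<And>x. x \<in> U \<Longrightarrow> x \<in> carrier V"
    using linear_subspaceD(1)[OF assms(1)] by auto
  fix x assume "x \<in> carrier (restrict_space V U)"
  then have x: "x \<in> U" by (simp add: restrict_space_def)
  then have "scl V (- 1) x \<in> U" by (rule linear_subspaceD[OF assms(1)])
  then show "\<exists>y\<in>carrier (restrict_space V U).
      add (restrict_space V U) x y = zero (restrict_space V U)"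
    using add_minus[OF U[OF x]] by (auto simp: restrict_space_def)
qed (use assms linear_subspaceD(1)[OF assms(1)] in \<open>auto simp: restrict_space_def subset_iff
    linear_subspaceD add_assoc add_zero scl_add add_scl scl_scl scl_one twist_add twist_scl
    intro: add_comm\<close>)

end

lemma space_hom_restrict:
  assumes "f \<in> space_hom V W" "U \<subseteq> carrier V" "f ` U \<subseteq> U'"
  shows "f \<in> space_hom (restrict_space V U) (restrict_space W U')"
  using assms by (auto simp: space_hom_def restrict_space_def subset_iff)

text \<open>The first isomorphism theorem used twice: \<open>A\<close> and \<open>B\<close> are both
  \<open>V\<close> modulo the common kernel. Only the operations of \<open>A\<close> and
  \<open>B\<close> are given; the vector space axioms reach them through the surjections.\<close>

lemma space_isomorphic_if_same_kernel:
  assumes V: "hom_vector_space V"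
    and f: "f \<in> space_hom V A" "f ` carrier V = carrier A" "f (zero V) = zero A"
    and g: "g \<in> space_hom V B" "g ` carrier V = carrier B" "g (zero V) = zero B"
    and ker: "\<And>x. x \<in> carrier V \<Longrightarrow> f x = zero A \<longleftrightarrow> g x = zero B"
  shows "space_isomorphic A B"
proof -
  interpret V: hom_vector_space V by fact
  interpret A: hom_vector_space A by (rule V.image_hom_vector_space[OF f])
  interpret B: hom_vector_space B by (rule V.image_hom_vector_space[OF g])
  \<comment> \<open>Equal kernels give equal fibres: apply \<open>ker\<close> to the difference of
    \<open>x\<close> and \<open>y\<close>.\<close>
  have fg: "f x = f y \<longleftrightarrow> g x = g y" if "x \<in> carrier V" "y \<in> carrier V" for x y
    using that V.space_hom_eq_iff[OF A.hom_vector_space_axioms f(1)]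
      V.space_hom_eq_iff[OF B.hom_vector_space_axioms g(1)]
      ker by (simp add: V.add_closed V.scl_closed)
  \<comment> \<open>An arbitrary preimage under \<open>f\<close> will do, since by \<open>fg\<close>
    the value of \<open>g\<close> is constant on the fibres of \<open>f\<close>.\<close>
  define k where "k a = g (SOME x. x \<in> carrier V \<and> f x = a)" for a
  have kf: "k (f x) = g x" if "x \<in> carrier V" for x
  proof -
    have "\<exists>x'. x' \<in> carrier V \<and> f x' = f x" using that by blast
    from someI_ex[OF this] show ?thesis
      unfolding k_def using fg that by metis
  qed
  have "k \<in> space_hom A B"
    unfolding space_hom_def f(2)[symmetric]
    by (auto simp: kf space_homD[OF g(1)] space_homD(2-4)[OF f(1), symmetric] V.add_closed V.scl_closed
        V.twist_closed)
  moreover have "bij_betw k (carrier A) (carrier B)"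
    unfolding bij_betw_def inj_on_def f(2)[symmetric] g(2)[symmetric]
    by (auto simp: kf fg) (metis image_eqI kf)
  ultimately show ?thesis
    unfolding space_isomorphic_def
    using A.hom_vector_space_axioms B.hom_vector_space_axioms by blast
qed


section \<open>Quotients\<close>

text \<open>The form that well-definedness takes here: operations on quotients are unions over
  representatives, and such a union is a single coset as soon as all its members agree. The element
  \<open>x0\<close> excludes the empty union.\<close>

lemma UN_const:
  assumes "x0 \<in> X" "\<And>x. x \<in> X \<Longrightarrow> F x = C"
  shows "(\<Union>x\<in>X. F x) = C"
  using assms by auto

locale hom_subspace = hom_vector_space V for V :: "('k::field, 'a, 'm) hom_space_scheme" +
  fixes U :: "'a set"
  assumes subspace: "linear_subspace V U"
begin

lemmas U_closed = linear_subspaceD(2-4)[OF subspace]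

lemma U_carrier: "u \<in> U \<Longrightarrow> u \<in> carrier V"
  using linear_subspaceD(1)[OF subspace] by auto

lemma in_coset_iff:
  "\<lbrakk>x \<in> carrier V; y \<in> carrier V\<rbrakk> \<Longrightarrow> y \<in> coset V U x \<longleftrightarrow> add V y (scl V (- 1) x) \<in> U"
proof (intro iffI)
  assume x: "x \<in> carrier V" and y: "y \<in> carrier V"
  { assume "y \<in> coset V U x"
    then obtain u where u: "u \<in> U" "y = add V x u" by (auto simp: coset_def)
    then have "add V y (scl V (- 1) x) = u"
      using x U_carrier[OF u(1)]
      by (simp add: add_assoc scl_closed add_left_comm[of x u] add_minus add_zero_right)
    with u show "add V y (scl V (- 1) x) \<in> U" by simp }
  assume "add V y (scl V (- 1) x) \<in> U"
  then show "y \<in> coset V U x"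
    unfolding coset_def using add_minus_cancel[OF y x] by force
qed

lemma coset_self: "x \<in> carrier V \<Longrightarrow> x \<in> coset V U x"
  by (simp add: in_coset_iff add_minus U_closed)

lemma coset_absorb:
  assumes "x \<in> carrier V" "u \<in> U"
  shows "coset V U (add V x u) = coset V U x"
proof (rule equalityI; rule subsetI)
  fix y assume "y \<in> coset V U (add V x u)"
  then show "y \<in> coset V U x"
    using assms by (auto simp: coset_def add_assoc U_carrier U_closed)
next
  fix y assume "y \<in> coset V U x"
  then obtain v where v: "v \<in> U" "y = add V x v" by (auto simp: coset_def)
  have "y = add V (add V x u) (add V v (scl V (- 1) u))"
    using v assms by (simp add: add_assoc U_carrier U_closed add_minus_cancel)
  then show "y \<in> coset V U (add V x u)"
    using v assms by (auto simp: coset_def U_closed)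
qed

lemma coset_eq_iff:
  assumes "x \<in> carrier V" "y \<in> carrier V"
  shows "coset V U x = coset V U y \<longleftrightarrow> add V x (scl V (- 1) y) \<in> U"
proof
  assume "coset V U x = coset V U y"
  then have "x \<in> coset V U y" using coset_self[OF assms(1)] by simp
  then show "add V x (scl V (- 1) y) \<in> U" using assms by (simp add: in_coset_iff)
next
  assume "add V x (scl V (- 1) y) \<in> U"
  from coset_absorb[OF assms(2) this] show "coset V U x = coset V U y"
    using assms by (simp add: add_minus_cancel)
qed

lemma coset_eq_zero_iff: "x \<in> carrier V \<Longrightarrow> coset V U x = coset V U (zero V) \<longleftrightarrow> x \<in> U"
  by (simp add: coset_eq_iff zero_closed scl_zero add_zero_right)

lemma Union_coset_eq:
  assumes x: "x \<in> carrier V"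
    and F: "\<And>u. u \<in> U \<Longrightarrow> F (add V x u) = F x"
  shows "(\<Union>x'\<in>coset V U x. F x') = F x"
  by (rule UN_const[OF coset_self[OF x]]) (auto simp: coset_def F)

end

text \<open>Stability of \<open>U\<close> under the twist is what lets the twist descend to the
  quotient.\<close>

locale twist_subspace = hom_subspace +
  assumes twist_U: "u \<in> U \<Longrightarrow> twist V u \<in> U"
begin

lemma coset_space_hom: "coset V U \<in> space_hom V (quotient_space V U)"
proof -
  have "(\<Union>x'\<in>coset V U x. \<Union>y'\<in>coset V U y. coset V U (add V x' y')) = coset V U (add V x y)"
    if x: "x \<in> carrier V" and y: "y \<in> carrier V" for x y
  proof (intro UN_const[OF coset_self[OF x]] UN_const[OF coset_self[OF y]])
    fix x' y' assume "x' \<in> coset V U x" "y' \<in> coset V U y"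
    then obtain u v where u: "u \<in> U" "v \<in> U" and x': "x' = add V x u" and y': "y' = add V y v"
      by (auto simp: coset_def)
    \<comment> \<open>Regrouped so that the two errors form one element of \<open>U\<close>, which
      the coset absorbs.\<close>
    have "add V x' y' = add V (add V x y) (add V u v)"
      using x y u unfolding x' y' by (simp add: add_assoc add_closed add_left_comm U_carrier)
    then show "coset V U (add V x' y') = coset V U (add V x y)"
      using x y u by (simp add: coset_absorb add_closed U_closed)
  qed
  moreover have "(\<Union>x'\<in>coset V U x. coset V U (scl V c x')) = coset V U (scl V c x)"
    if x: "x \<in> carrier V" for x c
    using x by (intro Union_coset_eq[where F = "\<lambda>x. coset V U (scl V c x)"])
      (auto simp: scl_add U_carrier coset_absorb U_closed scl_closed)
  moreover have "(\<Union>x'\<in>coset V U x. coset V U (twist V x')) = coset V U (twist V x)"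
    if x: "x \<in> carrier V" for x
    using x by (intro Union_coset_eq[where F = "\<lambda>x. coset V U (twist V x)"])
      (auto simp: twist_add U_carrier coset_absorb twist_U twist_closed)
  ultimately show ?thesis
    by (auto simp: space_hom_def quotient_space_def)
qed

lemma coset_image: "coset V U ` carrier V = carrier (quotient_space V U)"
  by (simp add: quotient_space_def)

lemma coset_zero: "coset V U (zero V) = zero (quotient_space V U)"
  by (simp add: quotient_space_def)

end


section \<open>Presented Hom-Lie algebras\<close>

lemma term_class_eq_iff: "term_class R s = term_class R t \<longleftrightarrow> hom_lie_cong R s t"
  unfolding term_class_def
  by (auto intro: hom_lie_cong.trans hom_lie_cong.sym hom_lie_cong.refl)

lemma in_term_class_iff: "s \<in> term_class R t \<longleftrightarrow> hom_lie_cong R t s"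
  by (simp add: term_class_def)

lemma term_class_self: "t \<in> term_class R t"
  by (simp add: in_term_class_iff hom_lie_cong.refl)

lemma presented_ops:
  "zero (presented_hom_lie R) = term_class R Zero"
  "add (presented_hom_lie R) (term_class R s) (term_class R t) = term_class R (Add s t)"
  "scl (presented_hom_lie R) c (term_class R t) = term_class R (Scale c t)"
  "twist (presented_hom_lie R) (term_class R t) = term_class R (Twist t)"
  "bracket (presented_hom_lie R) (term_class R s) (term_class R t) = term_class R (Bracket s t)"
  unfolding presented_hom_lie_def
  by (simp_all, (intro UN_const[OF term_class_self],
      simp add: term_class_eq_iff in_term_class_iff, blast intro: hom_lie_cong.intros)+)

lemma presented_carrier: "carrier (presented_hom_lie R) = range (term_class R)"
  by (simp add: presented_hom_lie_def)

lemma term_class_carrier [simp]: "term_class R t \<in> carrier (presented_hom_lie R)"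
  by (simp add: presented_carrier)

lemma presented_cases:
  assumes "x \<in> carrier (presented_hom_lie R)"
  obtains t where "x = term_class R t"
  using assms by (auto simp: presented_carrier)

lemma presented_hom_vector_space: "hom_vector_space (presented_hom_lie R)"
proof
  fix x assume "x \<in> carrier (presented_hom_lie R)"
  then obtain t where "x = term_class R t" by (rule presented_cases)
  then show "\<exists>y\<in>carrier (presented_hom_lie R). add (presented_hom_lie R) x y = zero (presented_hom_lie R)"
    by (intro bexI[of _ "term_class R (Scale (- 1) t)"])
      (simp_all add: presented_ops term_class_eq_iff hom_lie_cong.add_inverse)
qed (((elim presented_cases)?, simp add: presented_ops term_class_eq_iff hom_lie_cong.add_assoc
    hom_lie_cong.add_comm hom_lie_cong.add_zero hom_lie_cong.scale_add hom_lie_cong.add_scale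
    hom_lie_cong.scale_scale hom_lie_cong.scale_one hom_lie_cong.twist_add hom_lie_cong.twist_scale)+)


section \<open>Free vector spaces\<close>

lemma lookup_fscale [simp]: "Poly_Mapping.lookup (fscale c f) x = c * Poly_Mapping.lookup f x"
  by (simp add: fscale_def Poly_Mapping.map.rep_eq when_def)

lemma keys_fscale: "Poly_Mapping.keys (fscale c f) \<subseteq> Poly_Mapping.keys f"
  by (auto simp: in_keys_iff)

lemma keys_add_subset:
  "\<lbrakk>Poly_Mapping.keys f \<subseteq> S; Poly_Mapping.keys g \<subseteq> S\<rbrakk> \<Longrightarrow> Poly_Mapping.keys (f + g) \<subseteq> S"
  using Poly_Mapping.keys_add[of f g] by blast

lemma keys_fscale_subset: "Poly_Mapping.keys f \<subseteq> S \<Longrightarrow> Poly_Mapping.keys (fscale c f) \<subseteq> S"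
  using keys_fscale[of c f] by blast

lemma keys_diff_subset:
  "\<lbrakk>Poly_Mapping.keys f \<subseteq> S; Poly_Mapping.keys g \<subseteq> S\<rbrakk>
    \<Longrightarrow> Poly_Mapping.keys (f - g :: 'x \<Rightarrow>\<^sub>0 'k::field) \<subseteq> S"
  using Poly_Mapping.keys_diff[of f g] by blast

lemma keys_basis [simp]: "Poly_Mapping.keys (basis x :: 'x \<Rightarrow>\<^sub>0 'k::field) = {x}"
  by (simp add: basis_def)

lemma lookup_basis: "Poly_Mapping.lookup (basis x) y = (if x = y then 1 else 0)"
  by (simp add: basis_def lookup_single when_def)

lemma vector_space_fscale: "vector_space (fscale :: 'k::field \<Rightarrow> ('x \<Rightarrow>\<^sub>0 'k) \<Rightarrow> _)"
  by standard (auto intro!: poly_mapping_eqI simp: lookup_add algebra_simps)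

interpretation fs: vector_space "fscale :: 'k::field \<Rightarrow> ('x \<Rightarrow>\<^sub>0 'k) \<Rightarrow> _"
  by (rule vector_space_fscale)

text \<open>One notion for two kinds of target: with values in a free space it is
  \<open>linear_extension\<close>, with values in \<open>L\<close> it gives the bracket on pairs and
  the identification of degree one with \<open>L\<close>.\<close>

definition (in vector_space) lift :: "('x \<Rightarrow> 'b) \<Rightarrow> ('x \<Rightarrow>\<^sub>0 'a) \<Rightarrow> 'b" where
  "lift g f = (\<Sum>x\<in>Poly_Mapping.keys f. scale (Poly_Mapping.lookup f x) (g x))"

lemma linear_extension_eq_lift: "linear_extension = fs.lift"
  by (intro ext) (simp add: linear_extension_def fs.lift_def)

context vector_space
begin

text \<open>Supports may shrink under addition and scaling, so sums are compared over a common
  finite set containing all of them.\<close>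

lemma lift_superset:
  "\<lbrakk>finite A; Poly_Mapping.keys f \<subseteq> A\<rbrakk> \<Longrightarrow>
    lift g f = (\<Sum>x\<in>A. scale (Poly_Mapping.lookup f x) (g x))"
  unfolding lift_def by (intro sum.mono_neutral_left) (auto simp: in_keys_iff)

lemma lift_add: "lift g (f + f') = lift g f + lift g f'"
proof -
  let ?A = "Poly_Mapping.keys f \<union> Poly_Mapping.keys f'"
  have "Poly_Mapping.keys (f + f') \<subseteq> ?A" by (rule Poly_Mapping.keys_add)
  then show ?thesis
    by (simp add: lift_superset[of ?A] lookup_add scale_left_distrib sum.distrib)
qed

lemma lift_scale: "lift g (fscale c f) = scale c (lift g f)"
  by (simp add: lift_superset[of "Poly_Mapping.keys f"] keys_fscale scale_sum_right)

lemma lift_basis: "lift g (basis x) = g x"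
  by (simp add: lift_def lookup_basis)

lemma lift_diff: "lift g (f - f') = lift g f - lift g f'"
  using lift_add[of g "f - f'" f'] by (simp add: algebra_simps)

lemma lift_zero: "lift g 0 = 0"
  by (simp add: lift_def)

lemma lift_minus: "lift g (- f) = - lift g f"
  using lift_diff[of g 0 f] by (simp add: lift_zero)

lemmas lift_simps = lift_add lift_scale lift_basis lift_diff lift_zero lift_minus

end

lemma free_space_simps [simp]:
  "carrier (free_space S \<phi>) = {f. Poly_Mapping.keys f \<subseteq> S}"
  "zero (free_space S \<phi>) = 0"
  "add (free_space S \<phi>) = (+)"
  "scl (free_space S \<phi>) = fscale"
  "twist (free_space S \<phi>) = fs.lift (\<lambda>x. basis (\<phi> x))"
  by (simp_all add: free_space_def linear_extension_eq_lift)

lemma lift_basis_id: "fs.lift basis f = (f :: 'x \<Rightarrow>\<^sub>0 'k::field)"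
proof (rule poly_mapping_eqI)
  have "Poly_Mapping.lookup (\<Sum>x\<in>A. g x) y = (\<Sum>x\<in>A. Poly_Mapping.lookup (g x) y)"
    if "finite A" for A :: "'x set" and g :: "'x \<Rightarrow> ('x \<Rightarrow>\<^sub>0 'k)" and y
    using that by induction (auto simp: lookup_add)
  then show "Poly_Mapping.lookup (fs.lift basis f) x = Poly_Mapping.lookup f x" for x
    by (simp add: fs.lift_def lookup_basis in_keys_iff if_distrib[of "(*) _"] cong: if_cong)
qed

text \<open>Serves as induction over linear combinations: a property that cuts out a subspace holds
  everywhere once it holds on basis vectors.\<close>

lemma free_space_least:
  assumes U: "linear_subspace (free_space S \<phi>) U" and S: "\<And>x. x \<in> S \<Longrightarrow> basis x \<in> U"
    and f: "Poly_Mapping.keys f \<subseteq> S"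
  shows "f \<in> U"
proof -
  have "(\<Sum>x\<in>A. fscale (c x) (basis x)) \<in> U" if "finite A" "A \<subseteq> S" for A c
    using that by induction (use S linear_subspaceD(2-4)[OF U] in auto)
  from this[OF finite_keys f] have "fs.lift basis f \<in> U"
    by (simp add: fs.lift_def)
  then show ?thesis by (simp add: lift_basis_id)
qed

lemma lift_vimage_subspace:
  assumes U: "linear_subspace (free_space T \<psi>) U"
  shows "linear_subspace (free_space S \<phi>) {f. Poly_Mapping.keys f \<subseteq> S \<and> fs.lift g f \<in> U}"
  unfolding linear_subspace_def
  using linear_subspaceD(2-4)[OF U]
  by (simp add: fs.lift_simps keys_add_subset keys_fscale_subset Collect_mono_iff)

lemma lift_closed:
  assumes U: "linear_subspace (free_space T \<psi>) U" and "Poly_Mapping.keys f \<subseteq> S"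
    and "\<And>x. x \<in> S \<Longrightarrow> g x \<in> U"
  shows "fs.lift g f \<in> U"
proof -
  from free_space_least[OF lift_vimage_subspace[OF U, where S = S]] assms(2,3) show ?thesis
    by (auto simp: fs.lift_simps)
qed

lemma free_space_carrier:
  "linear_subspace (free_space S \<phi>) {f. Poly_Mapping.keys f \<subseteq> S}"
  by (simp add: linear_subspace_def keys_add_subset keys_fscale_subset)

lemma free_hom_vector_space:
  assumes "\<And>x. x \<in> S \<Longrightarrow> \<phi> x \<in> S"
  shows "hom_vector_space (free_space S \<phi> :: ('k::field, 'x \<Rightarrow>\<^sub>0 'k) hom_space)"
proof -
  let ?V = "free_space S \<phi> :: ('k, 'x \<Rightarrow>\<^sub>0 'k) hom_space"
  note c = linear_subspaceD(2-4)[OF free_space_carrier[of S \<phi>]]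
  show ?thesis
  proof
    fix x assume "x \<in> carrier ?V"
    then show "\<exists>y\<in>carrier ?V. add ?V x y = zero ?V"
      by (intro bexI[of _ "- x"]) auto
    show "twist ?V x \<in> carrier ?V"
      using \<open>x \<in> carrier ?V\<close> assms
        lift_closed[OF free_space_carrier[of S \<phi>], where f = x and S = S and g = "\<lambda>x. basis (\<phi> x)"]
      by simp
  qed (use c in \<open>simp_all add: fs.lift_simps ac_simps fs.scale_right_distrib fs.scale_left_distrib\<close>)
qed

text \<open>Universal property of the free space. The target is a carrier inside a type without
  addition of its own, so \<open>finprod\<close> in its additive group replaces the ordinary
  sum.\<close>

lemma (in hom_vector_space) free_extension:
  fixes \<phi> :: "'x \<Rightarrow> 'x"
  assumes g: "g \<in> S \<rightarrow> carrier V" and \<phi>: "\<And>x. x \<in> S \<Longrightarrow> \<phi> x \<in> S"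
    and tw: "\<And>x. x \<in> S \<Longrightarrow> g (\<phi> x) = twist V (g x)"
  obtains h where "h \<in> space_hom (free_space S \<phi>) V" "\<And>x. x \<in> S \<Longrightarrow> h (basis x) = g x"
proof -
  let ?M = "additive_group V" and ?F = "free_space S \<phi> :: ('k, 'x \<Rightarrow>\<^sub>0 'k) hom_space"
  interpret F: hom_vector_space ?F by (rule free_hom_vector_space[OF \<phi>])
  define h where
    "h f = finprod ?M (\<lambda>x. scl V (Poly_Mapping.lookup f x) (g x)) (Poly_Mapping.keys f)" for f
  have gc: "scl V c (g x) \<in> carrier V" if "x \<in> S" for c x
    using g that by (auto intro: scl_closed)
  \<comment> \<open>The index set in the definition of \<open>h\<close> depends on \<open>f\<close>;
    additivity needs one index set for several arguments, and coefficients outside the support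
    contribute zero by \<open>scl_0\<close>.\<close>
  have super: "h f = finprod ?M (\<lambda>x. scl V (Poly_Mapping.lookup f x) (g x)) A"
    if "finite A" "Poly_Mapping.keys f \<subseteq> A" "A \<subseteq> S" for f A
    unfolding h_def using that gc g
    by (intro additive.finprod_mono_neutral_cong_left) (auto simp: in_keys_iff intro!: scl_0)
  have closed: "h f \<in> carrier V" if "Poly_Mapping.keys f \<subseteq> S" for f
    using additive.finprod_closed[of "\<lambda>x. scl V (Poly_Mapping.lookup f x) (g x)" "Poly_Mapping.keys f"] gc that
    by (auto simp: h_def Pi_iff subset_iff)
  have h_add: "h (f + f') = add V (h f) (h f')"
    if f: "Poly_Mapping.keys f \<subseteq> S" "Poly_Mapping.keys f' \<subseteq> S" for f f'
  proof -
    let ?A = "Poly_Mapping.keys f \<union> Poly_Mapping.keys f'"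
    have A: "finite ?A" "?A \<subseteq> S" "Poly_Mapping.keys (f + f') \<subseteq> ?A"
      using f Poly_Mapping.keys_add[of f f'] by auto
    have "h (f + f') = finprod ?M (\<lambda>x. add V (scl V (Poly_Mapping.lookup f x) (g x))
        (scl V (Poly_Mapping.lookup f' x) (g x))) ?A"
      using A(2) g unfolding super[OF A(1,3,2)]
      by (intro additive.finprod_cong') (auto simp: lookup_add add_scl Pi_iff subset_iff intro!: add_closed gc)
    also have "\<dots> = add V (h f) (h f')"
    proof -
      have "(\<lambda>x. scl V (Poly_Mapping.lookup k x) (g x)) \<in> ?A \<rightarrow> carrier V" for k
        using subsetD[OF A(2)] by (intro Pi_I gc)
      from additive.finprod_multf[unfolded additive_group_simps, OF this this] show ?thesis
        using A(1,2) by (simp add: super[of ?A])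
    qed
    finally show ?thesis .
  qed
  have scale_finprod: "finprod ?M (\<lambda>x. scl V c (k x)) A = scl V c (finprod ?M k A)"
    if "finite A" "k \<in> A \<rightarrow> carrier V" for A k c
    using that
  proof induction
    case (insert x A)
    then show ?case
      using additive.finprod_closed[of k A] by (simp add: scl_add scl_closed Pi_iff)
  qed (simp add: scl_zero)
  have h_scl: "h (fscale c f) = scl V c (h f)" if "Poly_Mapping.keys f \<subseteq> S" for c f
  proof -
    have "h (fscale c f) =
        finprod ?M (\<lambda>x. scl V c (scl V (Poly_Mapping.lookup f x) (g x))) (Poly_Mapping.keys f)"
      using that g unfolding super[OF finite_keys keys_fscale that]
      by (intro additive.finprod_cong') (auto simp: scl_scl Pi_iff subset_iff intro!: scl_closed gc)
    then show ?thesis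
      using that gc by (simp add: scale_finprod Pi_iff subset_iff h_def)
  qed
  have h_basis: "h (basis x) = g x" if "x \<in> S" for x
    using that g additive.finprod_insert[of "{}" x "\<lambda>y. scl V (Poly_Mapping.lookup (basis x) y) (g y)"]
    by (auto simp: h_def lookup_basis scl_one Pi_iff add_zero_right)
  have h_zero: "h 0 = zero V" by (simp add: h_def)
  \<comment> \<open>Commuting with the twist is a linear condition on \<open>f\<close>, so it is
    enough to have it on basis vectors, where it is \<open>tw\<close>.\<close>
  have "linear_subspace ?F {f \<in> carrier ?F. h (twist ?F f) = twist V (h f)}"
    using F.linear_subspace_carrier F.twist_closed
    by (auto simp: linear_subspace_def fs.lift_simps h_add h_scl h_zero twist_zero twist_add
        twist_scl closed)
  from free_space_least[OF this] have "h (twist ?F f) = twist V (h f)" if "f \<in> carrier ?F" for f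
    using that by (auto simp: fs.lift_simps h_basis \<phi> tw)
  then have "h \<in> space_hom ?F V"
    by (auto simp: space_hom_def closed h_add h_scl)
  with h_basis that show thesis by blast
qed


section \<open>The exterior square and the boundary maps\<close>

text \<open>Isolating \<open>[x, x] = 0\<close> makes everything below uniform in the
  characteristic: it is \<open>br_self\<close> when 2 is invertible and a hypothesis of the theorem
  in characteristic 2.\<close>

locale alternating_hom_lie = hom_lie_algebra +
  assumes br_alt: "br x x = 0"
begin

lemma \<alpha>_simps: "\<alpha> (x + y) = \<alpha> x + \<alpha> y" "\<alpha> (c *s x) = c *s \<alpha> x"
proof -
  interpret Vector_Spaces.linear scale scale \<alpha> by (rule \<alpha>_linear)
  show "\<alpha> (x + y) = \<alpha> x + \<alpha> y" "\<alpha> (c *s x) = c *s \<alpha> x"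
    by (simp_all add: add scale)
qed

lemma br_simps:
  "br (x + y) z = br x z + br y z" "br (c *s x) z = c *s br x z" "br 0 z = 0" "br (- x) z = - br x z"
  "br z (x + y) = br z x + br z y" "br z (c *s x) = c *s br z x" "br z 0 = 0" "br z (- x) = - br z x"
proof -
  interpret l: Vector_Spaces.linear scale scale "\<lambda>x. br x z" by (rule br_linear_left)
  interpret r: Vector_Spaces.linear scale scale "br z" by (rule br_linear_right)
  show "br (x + y) z = br x z + br y z" "br (c *s x) z = c *s br x z" "br 0 z = 0"
    "br (- x) z = - br x z" "br z (x + y) = br z x + br z y" "br z (c *s x) = c *s br z x"
    "br z 0 = 0" "br z (- x) = - br z x"
    by (simp_all add: l.add l.scale l.zero l.neg r.add r.scale r.zero r.neg)
qed

section \<open>Free spaces on tuples\<close>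

abbreviation pair :: "'b \<Rightarrow> 'b \<Rightarrow> ('b list \<Rightarrow>\<^sub>0 'a)" where
  "pair x y \<equiv> basis [x, y]"

abbreviation tuples :: "nat \<Rightarrow> ('b list \<Rightarrow>\<^sub>0 'a) set" where
  "tuples n \<equiv> {f. Poly_Mapping.keys f \<subseteq> {xs. length xs = n}}"

abbreviation tuple_twist :: "('b list \<Rightarrow>\<^sub>0 'a) \<Rightarrow> ('b list \<Rightarrow>\<^sub>0 'a)" where
  "tuple_twist \<equiv> fs.lift (\<lambda>xs. basis (map \<alpha> xs))"

abbreviation tuple_boundary :: "('b list \<Rightarrow>\<^sub>0 'a) \<Rightarrow> ('b list \<Rightarrow>\<^sub>0 'a)" where
  "tuple_boundary \<equiv> fs.lift boundary_tuple"

text \<open>On representatives this is at once the commutator map and minus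
  \<open>d\<^sub>2\<close>; that coincidence is the reason the two sides of the theorem
  agree.\<close>

definition pair_br :: "('b list \<Rightarrow>\<^sub>0 'a) \<Rightarrow> 'b" where
  "pair_br = lift (\<lambda>xs. br (xs ! 0) (xs ! 1))"

lemma pair_br_simps:
  "pair_br (f + g) = pair_br f + pair_br g" "pair_br (fscale c f) = c *s pair_br f" "pair_br (f - g) = pair_br f - pair_br g"
  "pair_br 0 = 0" "pair_br (- f) = - pair_br f" "pair_br (pair x y) = br x y"
  by (simp_all add: pair_br_def lift_simps)

sublocale tuple: hom_vector_space "tuple_space n" for n
  unfolding tuple_space_def by (rule free_hom_vector_space) simp

lemma tuple_space_simps [simp]:
  "carrier (tuple_space n) = tuples n"
  "zero (tuple_space n) = 0"
  "add (tuple_space n) = (+)"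
  "scl (tuple_space n) = fscale"
  "twist (tuple_space n) = tuple_twist"
  by (simp_all add: tuple_space_def)

lemma tuples_least:
  assumes U: "linear_subspace (tuple_space n) U" and "\<And>xs. length xs = n \<Longrightarrow> basis xs \<in> U"
    and f: "f \<in> tuples n"
  shows "f \<in> U"
  using free_space_least[OF U[unfolded tuple_space_def]] assms by auto

lemma length_2_iff: "length xs = 2 \<longleftrightarrow> (\<exists>x y. xs = [x, y])"
  by (auto simp: numeral_2_eq_2 length_Suc_conv)

lemma length_3_iff: "length xs = 3 \<longleftrightarrow> (\<exists>x y z. xs = [x, y, z])"
  by (auto simp: numeral_3_eq_3 length_Suc_conv)

lemma less_2_iff: "i < 2 \<longleftrightarrow> i = 0 \<or> i = (1 :: nat)"
  by auto

lemma less_3_iff: "i < 3 \<longleftrightarrow> i = 0 \<or> i = 1 \<or> i = (2 :: nat)"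
  by auto

lemma tuples_2_least:
  assumes "linear_subspace (tuple_space 2) U" "\<And>x y. pair x y \<in> U" "f \<in> tuples 2"
  shows "f \<in> U"
  using tuples_least[OF assms(1) _ assms(3)] assms(2) by (auto simp: length_2_iff)

lemma tuples_3_least:
  assumes "linear_subspace (tuple_space 3) U" "\<And>x y z. basis [x, y, z] \<in> U" "f \<in> tuples 3"
  shows "f \<in> U"
  using tuples_least[OF assms(1) _ assms(3)] assms(2) by (auto simp: length_3_iff)

lemma subspace_closed:
  assumes "linear_subspace (tuple_space n) U"
  shows "0 \<in> U" "\<lbrakk>f \<in> U; g \<in> U\<rbrakk> \<Longrightarrow> f + g \<in> U" "f \<in> U \<Longrightarrow> fscale c f \<in> U"
    "f \<in> U \<Longrightarrow> - f \<in> U" "\<lbrakk>f \<in> U; g \<in> U\<rbrakk> \<Longrightarrow> f - g \<in> U"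
proof -
  note U = linear_subspaceD(2-4)[OF assms, simplified]
  show "0 \<in> U" "\<lbrakk>f \<in> U; g \<in> U\<rbrakk> \<Longrightarrow> f + g \<in> U" "f \<in> U \<Longrightarrow> fscale c f \<in> U"
    by (fact U)+
  show neg: "- f \<in> U" if "f \<in> U" for f
    using U(3)[OF that, of "- 1"] by simp
  show "\<lbrakk>f \<in> U; g \<in> U\<rbrakk> \<Longrightarrow> f - g \<in> U"
    using U(2)[of f "- g"] neg[of g] by simp
qed

lemma tuples_subspace: "linear_subspace (tuple_space n) (tuples n)"
  using tuple.linear_subspace_carrier[of n] by simp

lemmas tuples_closed = subspace_closed[OF tuples_subspace]

section \<open>The exterior relations and the twist\<close>

lemma exterior_relations_subset: "exterior_relations n \<subseteq> tuples n"
proof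
  fix f assume "f \<in> exterior_relations n"
  then show "f \<in> tuples n"
    by cases (simp_all add: keys_diff_subset keys_fscale_subset)
qed

lemma E_subspace: "linear_subspace (tuple_space n) (exterior_kernel n)"
  unfolding exterior_kernel_def
  using exterior_relations_subset by (intro tuple.linear_span_subspace) simp

lemmas E_closed = subspace_closed[OF E_subspace]

lemma E_relation: "f \<in> exterior_relations n \<Longrightarrow> f \<in> exterior_kernel n"
  unfolding exterior_kernel_def by (rule linear_span_base)

lemma E_tuples: "f \<in> exterior_kernel n \<Longrightarrow> f \<in> tuples n"
  using linear_subspaceD(1)[OF E_subspace[of n]] by auto

lemma E_least:
  assumes "linear_subspace (tuple_space n) U" "exterior_relations n \<subseteq> U" "f \<in> exterior_kernel n"
  shows "f \<in> U"
  using linear_span_least[OF assms(1,2)] assms(3) by (auto simp: exterior_kernel_def)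

text \<open>Checking the generating relations suffices, because the preimage of a subspace under a
  linear map is a subspace.\<close>

lemma lift_E:
  assumes U: "linear_subspace (tuple_space m) U"
    and "\<And>f. f \<in> exterior_relations n \<Longrightarrow> fs.lift g f \<in> U" and f: "f \<in> exterior_kernel n"
  shows "fs.lift g f \<in> U"
proof -
  have "linear_subspace (tuple_space n) {f \<in> tuples n. fs.lift g f \<in> U}"
    using lift_vimage_subspace[OF U[unfolded tuple_space_def]] by (simp add: tuple_space_def)
  from E_least[OF this _ f] show ?thesis
    using exterior_relations_subset assms(2) by auto
qed

text \<open>As \<alpha> is linear, applying it entrywise turns each relation into a relation of the
  same kind.\<close>

lemma tuple_twist_E:
  assumes "f \<in> exterior_kernel n"
  shows "tuple_twist f \<in> exterior_kernel n"
proof (rule lift_E[OF E_subspace _ assms])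
  fix f assume "f \<in> exterior_relations n"
  then show "tuple_twist f \<in> exterior_kernel n"
  proof cases
    case (multi_add xs i x y)
    then show ?thesis
      using exterior_relations.multi_add[of "map \<alpha> xs" n i "\<alpha> x" "\<alpha> y"]
      by (simp add: fs.lift_simps map_update \<alpha>_simps E_relation)
  next
    case (multi_scale xs i c x)
    then show ?thesis
      using exterior_relations.multi_scale[of "map \<alpha> xs" n i c "\<alpha> x"]
      by (simp add: fs.lift_simps map_update \<alpha>_simps E_relation)
  next
    case (alternating xs i j)
    then show ?thesis
      using exterior_relations.alternating[of "map \<alpha> xs" n i j]
      by (simp add: fs.lift_simps E_relation)
  qed
qed

sublocale E: twist_subspace "tuple_space n" "exterior_kernel n" for n
  by standard (auto simp: E_subspace tuple_twist_E)

section \<open>Calculation with pairs modulo the exterior relations\<close>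

lemma pair_relations:
  "pair (x + y) z - pair x z - pair y z \<in> exterior_kernel 2"
  "pair z (x + y) - pair z x - pair z y \<in> exterior_kernel 2"
  "pair (c *s x) z - fscale c (pair x z) \<in> exterior_kernel 2"
  "pair z (c *s x) - fscale c (pair z x) \<in> exterior_kernel 2"
  "pair x x \<in> exterior_kernel 2"
  using exterior_relations.multi_add[of "[x, z]" 2 0 x y] exterior_relations.multi_add[of "[z, x]" 2 1 x y]
    exterior_relations.multi_scale[of "[x, z]" 2 0 c x] exterior_relations.multi_scale[of "[z, x]" 2 1 c x]
    exterior_relations.alternating[of "[x, x]" 2 0 1]
  by (auto intro: E_relation)

text \<open>Polarisation: expand the pair \<open>(x + y, x + y)\<close> in both entries; it and the
  two diagonal terms are alternating relations.\<close>

lemma pair_skew: "pair x y + pair y x \<in> exterior_kernel 2"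
proof -
  have "pair x y + pair y x = pair (x + y) (x + y) - pair x x - pair y y
      - (pair (x + y) (x + y) - pair x (x + y) - pair y (x + y))
      - (pair x (x + y) - pair x x - pair x y) - (pair y (x + y) - pair y x - pair y y)"
    by simp
  also have "\<dots> \<in> exterior_kernel 2"
    by (intro E_closed pair_relations)
  finally show ?thesis .
qed

lemma pair_zero: "pair 0 x \<in> exterior_kernel 2"
  using pair_relations(3)[of 0 0 x] by simp

lemma pair_neg: "pair (- x) y + pair x y \<in> exterior_kernel 2"
  using pair_relations(3)[of "- 1" x y] by simp

section \<open>The boundary maps in degrees two and three on representatives\<close>

lemma boundary_tuple_2: "boundary_tuple [x, y] = - basis [br x y]"
  by (simp add: boundary_tuple_def numeral_2_eq_2 nths_Cons)

text \<open>The sign is minus for the index pairs (0, 1) and (1, 2), plus for (0, 2).\<close>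

lemma boundary_tuple_3:
  "boundary_tuple [x, y, z] = pair (br x z) (\<alpha> y) - pair (br x y) (\<alpha> z) - pair (br y z) (\<alpha> x)"
  by (simp add: boundary_tuple_def eval_nat_numeral nths_Cons)

lemma tuple_boundary_tuples_3:
  assumes "f \<in> tuples 3"
  shows "tuple_boundary f \<in> tuples 2"
proof (rule lift_closed[OF tuples_subspace[unfolded tuple_space_def]])
  show "Poly_Mapping.keys f \<subseteq> {xs. length xs = 3}" using assms by simp
  fix xs :: "'b list" assume "xs \<in> {xs. length xs = 3}"
  then obtain x y z where "xs = [x, y, z]" by (auto simp: length_3_iff)
  then show "boundary_tuple xs \<in> tuples 2"
    by (simp add: boundary_tuple_3 keys_diff_subset)
qed

text \<open>Makes \<open>d\<^sub>3\<close> well defined on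
  \<open>L\<^sup>\<and>\<^sup>3\<close>.\<close>

lemma tuple_boundary_E_3:
  assumes "f \<in> exterior_kernel 3"
  shows "tuple_boundary f \<in> exterior_kernel 2"
proof (rule lift_E[OF E_subspace _ assms])
  fix f assume "f \<in> exterior_relations 3"
  then show "tuple_boundary f \<in> exterior_kernel 2"
  proof cases
    case (multi_add xs i x y)
    then obtain a b c where xs: "xs = [a, b, c]" and i: "i = 0 \<or> i = 1 \<or> i = 2"
      by (auto simp: length_3_iff less_3_iff)
    let ?l = "\<lambda>x y z. pair (x + y) z - pair x z - pair y z" and ?r = "\<lambda>z x y. pair z (x + y) - pair z x - pair z y"
    \<comment> \<open>One disjunct for each position of the varied entry. It occurs once in each of
      the three summands, inside the bracket (\<open>?l\<close>, by bilinearity of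
      \<open>br\<close>) or as the twisted factor (\<open>?r\<close>, by linearity of
      \<alpha>).\<close>
    have "tuple_boundary f = ?l (br x c) (br y c) (\<alpha> b) - ?l (br x b) (br y b) (\<alpha> c) - ?r (br b c) (\<alpha> x) (\<alpha> y)
      \<or> tuple_boundary f = ?r (br a c) (\<alpha> x) (\<alpha> y) - ?l (br a x) (br a y) (\<alpha> c) - ?l (br x c) (br y c) (\<alpha> a)
      \<or> tuple_boundary f = ?l (br a x) (br a y) (\<alpha> b) - ?r (br a b) (\<alpha> x) (\<alpha> y) - ?l (br b x) (br b y) (\<alpha> a)"
      using i unfolding multi_add xs
      by (auto simp: fs.lift_simps boundary_tuple_3 br_simps \<alpha>_simps algebra_simps)
    then show ?thesis
      by (elim disjE) (auto intro!: E_closed(5) pair_relations)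
  next
    case (multi_scale xs i c x)
    then obtain a b d where xs: "xs = [a, b, d]" and i: "i = 0 \<or> i = 1 \<or> i = 2"
      by (auto simp: length_3_iff less_3_iff)
    let ?l = "\<lambda>x z. pair (c *s x) z - fscale c (pair x z)" and ?r = "\<lambda>z x. pair z (c *s x) - fscale c (pair z x)"
    have "tuple_boundary f = ?l (br x d) (\<alpha> b) - ?l (br x b) (\<alpha> d) - ?r (br b d) (\<alpha> x)
      \<or> tuple_boundary f = ?r (br a d) (\<alpha> x) - ?l (br a x) (\<alpha> d) - ?l (br x d) (\<alpha> a)
      \<or> tuple_boundary f = ?l (br a x) (\<alpha> b) - ?r (br a b) (\<alpha> x) - ?l (br b x) (\<alpha> a)"
      using i unfolding multi_scale xs
      by (auto simp: fs.lift_simps boundary_tuple_3 br_simps \<alpha>_simps fs.scale_right_diff_distrib algebra_simps)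
    then show ?thesis
      by (elim disjE) (auto intro!: E_closed(5) pair_relations)
  next
    case (alternating xs i j)
    then obtain a b c where "xs = [a, b, c]"
      by (auto simp: length_3_iff)
    with alternating have "f = basis [a, a, c] \<or> f = basis [a, b, a] \<or> f = basis [a, b, b]"
      by (auto simp: less_3_iff less_2_iff)
    \<comment> \<open>The equal entries produce one vanishing bracket. The other two summands cancel
      literally when the equal entries are adjacent, and through \<open>pair_neg\<close> when they
      are the outer two.\<close>
    moreover have "tuple_boundary (basis [a, a, c]) = - pair 0 (\<alpha> c)" "tuple_boundary (basis [a, b, b]) = - pair 0 (\<alpha> a)"
      by (simp_all add: fs.lift_simps boundary_tuple_3 br_alt)
    moreover have "tuple_boundary (basis [a, b, a]) = pair 0 (\<alpha> b) - (pair (- br a b) (\<alpha> a) + pair (br a b) (\<alpha> a))"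
      by (simp add: fs.lift_simps boundary_tuple_3 br_alt br_skew[of b a])
    ultimately show ?thesis
      by (auto intro!: E_closed pair_zero pair_neg simp del: add_uminus_conv_diff)
  qed
qed

text \<open>Holds on representatives and not just modulo relations, because \<alpha> is
  multiplicative.\<close>

lemma tuple_boundary_tuple_twist_3:
  assumes "f \<in> tuples 3"
  shows "tuple_boundary (tuple_twist f) = tuple_twist (tuple_boundary f)"
proof -
  have "linear_subspace (tuple_space 3) {f \<in> tuples 3. tuple_boundary (tuple_twist f) = tuple_twist (tuple_boundary f)}"
    by (simp add: linear_subspace_def fs.lift_simps keys_add_subset keys_fscale_subset Collect_mono_iff)
  from tuples_3_least[OF this _ assms] show ?thesis
    by (simp add: fs.lift_simps boundary_tuple_3 \<alpha>_br)
qed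

lemma tuple_twist_tuples: "f \<in> tuples n \<Longrightarrow> tuple_twist f \<in> tuples n"
  using tuple.twist_closed[of f n] by simp

lemma pair_br_subspace: "linear_subspace (tuple_space 2) {f \<in> tuples 2. pair_br f = 0}"
  by (simp add: linear_subspace_def pair_br_simps keys_add_subset keys_fscale_subset Collect_mono_iff)

lemma pair_br_tuple_twist:
  assumes "f \<in> tuples 2"
  shows "pair_br (tuple_twist f) = \<alpha> (pair_br f)"
proof -
  have "\<alpha> 0 = 0" using \<alpha>_simps(2)[of 0 0] by simp
  then have "linear_subspace (tuple_space 2) {f \<in> tuples 2. pair_br (tuple_twist f) = \<alpha> (pair_br f)}"
    by (simp add: linear_subspace_def pair_br_simps \<alpha>_simps fs.lift_simps keys_add_subset keys_fscale_subset
        Collect_mono_iff)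
  from tuples_2_least[OF this _ assms] show ?thesis
    by (simp add: fs.lift_simps pair_br_simps \<alpha>_br)
qed

lemma pair_br_E:
  assumes "f \<in> exterior_kernel 2"
  shows "pair_br f = 0"
proof -
  have "f \<in> {f \<in> tuples 2. pair_br f = 0}"
  proof (rule E_least[OF pair_br_subspace _ assms], rule subsetI)
    fix f assume f: "f \<in> exterior_relations 2"
    then have "pair_br f = 0"
      by cases (auto simp: length_2_iff less_2_iff less_Suc_eq pair_br_simps br_simps br_alt)
    with f show "f \<in> {f \<in> tuples 2. pair_br f = 0}"
      using exterior_relations_subset by auto
  qed
  then show ?thesis by simp
qed

lemma pair_br_bd_3:
  assumes "f \<in> tuples 3"
  shows "pair_br (tuple_boundary f) = 0"
proof -
  have "linear_subspace (tuple_space 3) {f \<in> tuples 3. pair_br (tuple_boundary f) = 0}"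
    by (simp add: linear_subspace_def fs.lift_simps pair_br_simps keys_add_subset keys_fscale_subset
        Collect_mono_iff)
  \<comment> \<open>Reversing the outer brackets, and the inner one in the first term, gives the
    Hom-Jacobi sum term by term.\<close>
  moreover have "br (br x z) (\<alpha> y) - br (br x y) (\<alpha> z) - br (br y z) (\<alpha> x) = 0" for x y z
    using br_hom_jacobi[of x y z] br_skew[of "br x z" "\<alpha> y"] br_skew[of "br x y" "\<alpha> z"]
      br_skew[of "br y z" "\<alpha> x"] br_skew[of x z] br_simps(8)[of "\<alpha> y" "br z x"]
    by (simp add: algebra_simps)
  ultimately show ?thesis
    using tuples_3_least[OF _ _ assms, of "{f \<in> tuples 3. pair_br (tuple_boundary f) = 0}"]
    by (simp add: fs.lift_simps pair_br_simps boundary_tuple_3)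
qed

section \<open>The preimage of the boundaries among pairs\<close>

text \<open>The preimage of \<open>Im d\<^sub>3\<close> in the free space on pairs.\<close>

definition bounding :: "('b list \<Rightarrow>\<^sub>0 'a) set" where
  "bounding = {f. \<exists>g\<in>tuples 3. f - tuple_boundary g \<in> exterior_kernel 2}"

lemma bounding_I: "\<lbrakk>g \<in> tuples 3; f - tuple_boundary g \<in> exterior_kernel 2\<rbrakk> \<Longrightarrow> f \<in> bounding"
  unfolding bounding_def by (rule CollectI) (rule bexI)

lemma bounding_E:
  assumes "f \<in> bounding"
  obtains g where "g \<in> tuples 3" "f - tuple_boundary g \<in> exterior_kernel 2"
  using assms unfolding bounding_def by (elim CollectE[of f] bexE) (rule that)

lemma bounding_tuples:
  assumes "f \<in> bounding"
  shows "f \<in> tuples 2"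
proof -
  obtain g where "g \<in> tuples 3" "f - tuple_boundary g \<in> exterior_kernel 2"
    using assms by (rule bounding_E)
  from tuples_closed(2)[OF E_tuples[OF this(2)] tuple_boundary_tuples_3[OF this(1)]] show ?thesis
    by simp
qed

lemma bounding_subspace: "linear_subspace (tuple_space 2) bounding"
  unfolding linear_subspace_def
proof (intro conjI ballI allI)
  show "bounding \<subseteq> carrier (tuple_space 2)"
    by (rule subsetI) (simp only: tuple_space_simps bounding_tuples)
  show "zero (tuple_space 2) \<in> bounding"
    using bounding_I[of 0 0] by (simp add: fs.lift_simps E_closed)
  fix f assume f: "f \<in> bounding"
  obtain f' where f': "f' \<in> tuples 3" "f - tuple_boundary f' \<in> exterior_kernel 2" using f by (rule bounding_E)
  show "scl (tuple_space 2) c f \<in> bounding" for c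
    using E_closed(3)[OF f'(2), of c] bounding_I[OF tuples_closed(3)[OF f'(1), of c], of "fscale c f"]
    by (simp add: fs.lift_simps fs.scale_right_diff_distrib)
  fix g assume g: "g \<in> bounding"
  obtain g' where g': "g' \<in> tuples 3" "g - tuple_boundary g' \<in> exterior_kernel 2" using g by (rule bounding_E)
  show "add (tuple_space 2) f g \<in> bounding"
    using E_closed(2)[OF f'(2) g'(2)] bounding_I[OF tuples_closed(2)[OF f'(1) g'(1)], of "f + g"]
    by (simp add: fs.lift_simps add_diff_add)
qed

lemmas bounding_closed = subspace_closed[OF bounding_subspace]

lemma E_bounding: "f \<in> exterior_kernel 2 \<Longrightarrow> f \<in> bounding"
  using bounding_I[of 0 f] by (simp add: fs.lift_simps)

lemma tuple_boundary_bounding: "f \<in> tuples 3 \<Longrightarrow> tuple_boundary f \<in> bounding"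
  using bounding_I[of f "tuple_boundary f"] E_closed(1) by simp

lemma tuple_twist_bounding:
  assumes "f \<in> bounding"
  shows "tuple_twist f \<in> bounding"
proof -
  obtain g where g: "g \<in> tuples 3" "f - tuple_boundary g \<in> exterior_kernel 2"
    using assms by (rule bounding_E)
  have "tuple_twist g \<in> tuples 3" using tuple.twist_closed[of g 3] g(1) by simp
  moreover have "tuple_twist f - tuple_boundary (tuple_twist g) \<in> exterior_kernel 2"
    using tuple_twist_E[OF g(2)] g(1) by (simp add: fs.lift_simps tuple_boundary_tuple_twist_3)
  ultimately show ?thesis by (rule bounding_I)
qed

text \<open>This is \<open>d\<^sub>2 d\<^sub>3 = 0\<close>. It puts boundaries among the cycles,
  makes the bracket on pairs modulo \<open>bounding\<close> well defined, and makes the commutator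
  map independent of representatives.\<close>

lemma pair_br_bounding:
  assumes "f \<in> bounding"
  shows "pair_br f = 0"
proof -
  obtain g where "g \<in> tuples 3" "f - tuple_boundary g \<in> exterior_kernel 2"
    using assms by (rule bounding_E)
  with pair_br_E[OF this(2)] pair_br_bd_3[OF this(1)] show ?thesis
    by (simp add: pair_br_simps)
qed

text \<open>Up to interchanging factors this is \<open>d\<^sub>3\<close> of the triple; the last
  correction in the proof trades \<open>br x z\<close> for \<open>br z x\<close>. It yields both
  relations on products with a bracket and the Hom-Jacobi identity for values of terms.\<close>

lemma pair_jacobi: "pair (\<alpha> x) (br y z) + pair (\<alpha> y) (br z x) + pair (\<alpha> z) (br x y) \<in> bounding"
proof -
  have "pair (\<alpha> x) (br y z) + pair (\<alpha> y) (br z x) + pair (\<alpha> z) (br x y) =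
      tuple_boundary (basis [x, y, z]) + (pair (\<alpha> x) (br y z) + pair (br y z) (\<alpha> x))
      + (pair (\<alpha> y) (br z x) + pair (br z x) (\<alpha> y)) + (pair (\<alpha> z) (br x y) + pair (br x y) (\<alpha> z))
      - (pair (- br z x) (\<alpha> y) + pair (br z x) (\<alpha> y))"
    by (simp add: fs.lift_simps boundary_tuple_3 br_skew[of x z])
  also have "\<dots> \<in> bounding"
    using tuple_boundary_bounding[of "basis [x, y, z]"] by (intro bounding_closed(5) bounding_closed(2)[OF _ E_bounding[OF pair_skew]] E_bounding[OF pair_neg]) simp
  finally show ?thesis .
qed

section \<open>Degree one\<close>

text \<open>The map \<open>lift hd\<close> identifies \<open>L\<^sup>\<and>\<^sup>1\<close> with \<open>L\<close>, so that \<open>d\<^sub>2\<close> becomes minus the bracket.\<close>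

lemma E_1_iff:
  assumes "f \<in> tuples 1"
  shows "f \<in> exterior_kernel 1 \<longleftrightarrow> lift hd f = 0"
proof
  have length_1: "length xs = 1 \<longleftrightarrow> (\<exists>x. xs = [x])" for xs :: "'b list"
    by (auto simp: length_Suc_conv)
  have sub: "linear_subspace (tuple_space 1) {f \<in> tuples 1. lift hd f = 0}"
    by (simp add: linear_subspace_def lift_simps keys_add_subset keys_fscale_subset Collect_mono_iff)
  have rel: "lift hd f = 0" if "f \<in> exterior_relations 1" for f
    using that by cases (auto simp: length_Suc_conv lift_simps)
  assume "f \<in> exterior_kernel 1"
  from E_least[OF sub _ this] show "lift hd f = 0"
    using exterior_relations_subset[of 1] rel by auto
next
  have add: "basis [x + y] - basis [x] - basis [y] \<in> exterior_kernel 1"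
    and scale: "basis [c *s x] - fscale c (basis [x]) \<in> exterior_kernel 1" for x y c
    using exterior_relations.multi_add[of "[x]" 1 0 x y]
      exterior_relations.multi_scale[of "[x]" 1 0 c x] by (auto intro: E_relation)
  \<comment> \<open>A nonzero vector of the free space; only the scaling relation with
    \<open>c = 0\<close> makes it vanish in the quotient.\<close>
  have zero: "basis [0] \<in> exterior_kernel 1"
    using scale[of 0 0] by simp
  \<comment> \<open>Modulo the relations every \<open>f\<close> collapses to the single tuple
    holding its value \<open>lift hd f\<close>. If that value is 0, then \<open>f\<close> is
    congruent to \<open>basis [0]\<close>, hence to 0.\<close>
  have "linear_subspace (tuple_space 1) {f \<in> tuples 1. basis [lift hd f] - f \<in> exterior_kernel 1}"
    unfolding linear_subspace_def
  proof (intro conjI ballI allI)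
    show "zero (tuple_space 1) \<in> {f \<in> tuples 1. basis [lift hd f] - f \<in> exterior_kernel 1}"
      using zero by (simp add: lift_simps)
    fix f assume "f \<in> {f \<in> tuples 1. basis [lift hd f] - f \<in> exterior_kernel 1}"
    then have f: "f \<in> tuples 1" "basis [lift hd f] - f \<in> exterior_kernel 1" by simp_all
    show "scl (tuple_space 1) c f \<in> {f \<in> tuples 1. basis [lift hd f] - f \<in> exterior_kernel 1}" for c
    proof -
      have "basis [c *s lift hd f] - fscale c f =
          (basis [c *s lift hd f] - fscale c (basis [lift hd f])) + fscale c (basis [lift hd f] - f)"
        by (simp add: fs.scale_right_diff_distrib)
      also have "\<dots> \<in> exterior_kernel 1"
        by (intro E_closed(2,3) scale f(2))
      finally show ?thesis
        using f(1) by (simp add: lift_simps keys_fscale_subset)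
    qed
    fix g assume "g \<in> {f \<in> tuples 1. basis [lift hd f] - f \<in> exterior_kernel 1}"
    then have g: "g \<in> tuples 1" "basis [lift hd g] - g \<in> exterior_kernel 1" by simp_all
    have "basis [lift hd f + lift hd g] - (f + g) =
        (basis [lift hd f + lift hd g] - basis [lift hd f] - basis [lift hd g])
        + ((basis [lift hd f] - f) + (basis [lift hd g] - g))"
      by simp
    also have "\<dots> \<in> exterior_kernel 1"
      by (intro E_closed(2) add f(2) g(2))
    finally show "add (tuple_space 1) f g \<in> {f \<in> tuples 1. basis [lift hd f] - f \<in> exterior_kernel 1}"
      using f(1) g(1) by (simp add: lift_simps keys_add_subset)
  qed auto
  moreover have "basis xs \<in> {f \<in> tuples 1. basis [lift hd f] - f \<in> exterior_kernel 1}"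
    if "length xs = 1" for xs
    using that E_closed(1) by (cases xs) (auto simp: lift_simps)
  ultimately have f: "basis [lift hd f] - f \<in> exterior_kernel 1"
    using tuples_least[OF _ _ assms, of "{f \<in> tuples 1. basis [lift hd f] - f \<in> exterior_kernel 1}"]
    by simp
  assume "lift hd f = 0"
  with E_closed(5)[OF zero f] show "f \<in> exterior_kernel 1"
    by simp
qed

lemma tuple_boundary_tuples_2:
  assumes "f \<in> tuples 2"
  shows "tuple_boundary f \<in> tuples 1" "lift hd (tuple_boundary f) = - pair_br f"
proof -
  have "linear_subspace (tuple_space 2) {f \<in> tuples 2. tuple_boundary f \<in> tuples 1 \<and> lift hd (tuple_boundary f) = - pair_br f}"
    by (simp add: linear_subspace_def lift_simps fs.lift_simps pair_br_simps keys_add_subset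
        keys_fscale_subset Collect_mono_iff)
  moreover have "tuple_boundary (pair x y) \<in> tuples 1" "lift hd (tuple_boundary (pair x y)) = - pair_br (pair x y)" for x y
    by (simp_all add: fs.lift_simps lift_simps boundary_tuple_2 pair_br_simps)
  ultimately have "f \<in> {f \<in> tuples 2. tuple_boundary f \<in> tuples 1 \<and> lift hd (tuple_boundary f) = - pair_br f}"
    by (intro tuples_2_least[OF _ _ assms]) simp_all
  then show "tuple_boundary f \<in> tuples 1" "lift hd (tuple_boundary f) = - pair_br f" by simp_all
qed

lemma tuple_boundary_2_in_E_iff: "f \<in> tuples 2 \<Longrightarrow> tuple_boundary f \<in> exterior_kernel 1 \<longleftrightarrow> pair_br f = 0"
  using E_1_iff[OF tuple_boundary_tuples_2(1)] tuple_boundary_tuples_2(2) by simp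

text \<open>Reduces the union over representatives in \<open>boundary\<close> to one representative.
  The two hypotheses are supplied separately for \<open>d\<^sub>2\<close> and
  \<open>d\<^sub>3\<close>.\<close>

lemma boundary_coset:
  assumes f: "f \<in> tuples (Suc n)"
    and tuple_boundary: "\<And>f. f \<in> tuples (Suc n) \<Longrightarrow> tuple_boundary f \<in> tuples n"
    and E: "\<And>f. f \<in> exterior_kernel (Suc n) \<Longrightarrow> tuple_boundary f \<in> exterior_kernel n"
  shows "boundary (Suc n) (coset (tuple_space (Suc n)) (exterior_kernel (Suc n)) f) =
    coset (tuple_space n) (exterior_kernel n) (tuple_boundary f)"
  unfolding boundary_def linear_extension_eq_lift diff_Suc_1
proof (rule E.Union_coset_eq)
  show "f \<in> carrier (tuple_space (Suc n))" using f by simp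
  fix u assume u: "u \<in> exterior_kernel (Suc n)"
  show "coset (tuple_space n) (exterior_kernel n) (tuple_boundary (add (tuple_space (Suc n)) f u)) =
      coset (tuple_space n) (exterior_kernel n) (tuple_boundary f)"
    using E.coset_absorb[OF _ E[OF u], of "tuple_boundary f"] tuple_boundary[OF f] by (simp add: fs.lift_simps)
qed

section \<open>Cycles, boundaries and second homology\<close>

abbreviation cls :: "('b list \<Rightarrow>\<^sub>0 'a) \<Rightarrow> ('b list \<Rightarrow>\<^sub>0 'a) set" where
  "cls \<equiv> coset (tuple_space 2) (exterior_kernel 2)"

lemma exterior_power_carrier: "carrier (exterior_power 2) = cls ` tuples 2"
  by (simp add: exterior_power_def quotient_space_def)

lemma cls_hom: "cls \<in> space_hom (tuple_space 2) (exterior_power 2)"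
  unfolding exterior_power_def by (rule E.coset_space_hom)

lemma cls_zero: "cls 0 = zero (exterior_power 2)"
  by (simp add: exterior_power_def quotient_space_def)

lemma cycles_eq: "cycles 2 = cls ` {f \<in> tuples 2. pair_br f = 0}"
proof -
  have "boundary 2 (cls f) = zero (exterior_power 1) \<longleftrightarrow> pair_br f = 0" if f: "f \<in> tuples 2" for f
  proof -
    have "boundary 2 (cls f) = coset (tuple_space 1) (exterior_kernel 1) (tuple_boundary f)"
      using boundary_coset[of f 1] f tuple_boundary_tuples_2(1) tuple_boundary_2_in_E_iff[OF E_tuples] pair_br_E
      by (simp add: numeral_2_eq_2)
    moreover have "zero (exterior_power 1) = coset (tuple_space 1) (exterior_kernel 1) 0"
      by (simp add: exterior_power_def quotient_space_def)
    ultimately show ?thesis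
      using E.coset_eq_zero_iff[of "tuple_boundary f" 1] tuple_boundary_tuples_2(1)[OF f] tuple_boundary_2_in_E_iff[OF f] by simp
  qed
  then show ?thesis
    by (auto simp: cycles_def kernel_def exterior_power_carrier)
qed

text \<open>An element of \<open>bounding\<close> and the boundary it is congruent to have the same
  class, so passing to the full preimage adds no new classes.\<close>

lemma boundaries_eq: "boundaries 2 = cls ` bounding"
proof -
  have "boundary 3 (coset (tuple_space 3) (exterior_kernel 3) g) = cls (tuple_boundary g)"
    if g: "g \<in> tuples 3" for g
    using boundary_coset[of g 2] g tuple_boundary_tuples_3 tuple_boundary_E_3 by (simp add: numeral_3_eq_3 numeral_2_eq_2)
  then have "boundaries 2 = (\<lambda>g. cls (tuple_boundary g)) ` tuples 3"
    by (simp add: boundaries_def exterior_power_def quotient_space_def image_image)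
  also have "\<dots> = cls ` bounding"
  proof (rule equalityI; rule subsetI)
    fix X assume "X \<in> (\<lambda>g. cls (tuple_boundary g)) ` tuples 3"
    then show "X \<in> cls ` bounding" by (elim imageE) (simp add: tuple_boundary_bounding imageI)
  next
    fix X assume "X \<in> cls ` bounding"
    then obtain f where f: "f \<in> bounding" "X = cls f" by (elim imageE)
    obtain g where g: "g \<in> tuples 3" "f - tuple_boundary g \<in> exterior_kernel 2"
      using f(1) by (rule bounding_E)
    have "cls f = cls (tuple_boundary g)"
      using E.coset_eq_iff[of f 2 "tuple_boundary g"] bounding_tuples[OF f(1)] tuple_boundary_tuples_3[OF g(1)] g(2)
      by simp
    then show "X \<in> (\<lambda>g. cls (tuple_boundary g)) ` tuples 3"
      unfolding f(2) by (rule image_eqI) (rule g(1))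
  qed
  finally show ?thesis .
qed

text \<open>The common source of the two surjections: it is the preimage both of the 2-cycles and of
  the kernel of the commutator map.\<close>

definition cycle_space :: "('a, 'b list \<Rightarrow>\<^sub>0 'a) hom_space" where
  "cycle_space = restrict_space (tuple_space 2) {f \<in> tuples 2. pair_br f = 0}"

lemma tuple_twist_cycle_space: "\<lbrakk>f \<in> tuples 2; pair_br f = 0\<rbrakk> \<Longrightarrow> tuple_twist f \<in> tuples 2 \<and> pair_br (tuple_twist f) = 0"
  using tuple.twist_closed[of f 2] pair_br_tuple_twist[of f] \<alpha>_simps(2)[of 0 0] by simp

lemma cycle_space_hom_vector_space: "hom_vector_space cycle_space"
  unfolding cycle_space_def by (rule tuple.restrict_hom_vector_space[OF pair_br_subspace]) (use tuple_twist_cycle_space in auto)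

text \<open>Composing the projections of the two successive quotients exhibits the second homology
  as \<open>cycle_space\<close> modulo \<open>bounding\<close>.\<close>

lemma homology_hom:
  obtains q where "q \<in> space_hom cycle_space (homology 2)" "q ` carrier cycle_space = carrier (homology 2)"
    "q (zero cycle_space) = zero (homology 2)" "\<And>f. f \<in> carrier cycle_space \<Longrightarrow> q f = zero (homology 2) \<longleftrightarrow> f \<in> bounding"
proof -
  let ?C = "restrict_space (exterior_power 2) (cycles 2)"
  have Zc: "carrier cycle_space = {f \<in> tuples 2. pair_br f = 0}" "zero cycle_space = 0"
    by (simp_all add: cycle_space_def restrict_space_def)
  have cls: "cls \<in> space_hom cycle_space ?C"
    unfolding cycle_space_def by (rule space_hom_restrict[OF cls_hom]) (auto simp: cycles_eq)
  have surj: "cls ` carrier cycle_space = carrier ?C"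
    by (simp add: Zc restrict_space_def cycles_eq)
  have C0: "cls 0 = zero ?C"
    by (simp add: restrict_space_def cls_zero)
  interpret cycle_space: hom_vector_space cycle_space by (rule cycle_space_hom_vector_space)
  interpret C: hom_vector_space ?C
    by (rule cycle_space.image_hom_vector_space[OF cls surj]) (simp add: Zc C0)
  have BZ: "bounding \<subseteq> carrier cycle_space"
    unfolding Zc by (rule subsetI, rule CollectI, rule conjI, erule bounding_tuples, erule pair_br_bounding)
  interpret D: twist_subspace ?C "boundaries 2"
  proof
    have "linear_subspace cycle_space bounding"
      using bounding_subspace BZ by (simp add: linear_subspace_def cycle_space_def restrict_space_def)
    then show "linear_subspace ?C (boundaries 2)"
      unfolding boundaries_eq by (rule cycle_space.image_subspace[OF C.hom_vector_space_axioms cls])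
    fix u assume "u \<in> boundaries 2"
    then obtain f where f: "f \<in> bounding" "u = cls f" by (auto simp: boundaries_eq)
    then have "twist ?C u = cls (tuple_twist f)"
      using space_homD(4)[OF cls, of f] BZ by (auto simp: cycle_space_def restrict_space_def)
    with tuple_twist_bounding[OF f(1)] show "twist ?C u \<in> boundaries 2" by (simp add: boundaries_eq)
  qed
  let ?p = "coset ?C (boundaries 2)"
  have p: "?p \<in> space_hom ?C (homology 2)" "?p ` carrier ?C = carrier (homology 2)"
    "?p (zero ?C) = zero (homology 2)"
    unfolding homology_def by (fact D.coset_space_hom D.coset_image D.coset_zero)+
  have ker: "?p (cls f) = zero (homology 2) \<longleftrightarrow> f \<in> bounding" if f: "f \<in> carrier cycle_space" for f
  proof -
    have "?p (cls f) = zero (homology 2) \<longleftrightarrow> cls f \<in> cls ` bounding"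
      using D.coset_eq_zero_iff[of "cls f"] space_homD(1)[OF cls f] p(3) by (simp add: boundaries_eq)
    also have "\<dots> \<longleftrightarrow> f \<in> bounding"
    proof
      assume "cls f \<in> cls ` bounding"
      then obtain g where g: "g \<in> bounding" "cls f = cls g" by blast
      \<comment> \<open>\<open>bounding\<close> contains the exterior relations, so it is a union of
        classes and membership can be tested after applying \<open>cls\<close>.\<close>
      have "f - g \<in> exterior_kernel 2"
        using E.coset_eq_iff[of f 2 g] f g bounding_tuples[OF g(1)] by (simp add: Zc)
      from bounding_closed(2)[OF E_bounding[OF this] g(1)] show "f \<in> bounding" by simp
    qed blast
    finally show ?thesis .
  qed
  show thesis
  proof (rule that[of "?p \<circ> cls"])
    show "?p \<circ> cls \<in> space_hom cycle_space (homology 2)"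
      by (rule space_hom_compose[OF cls p(1)])
    show "(?p \<circ> cls) ` carrier cycle_space = carrier (homology 2)"
      unfolding image_comp[symmetric] surj p(2) ..
    show "(?p \<circ> cls) (zero cycle_space) = zero (homology 2)"
      using p(3) by (simp add: Zc C0)
  qed (simp add: ker)
qed


section \<open>The exterior product\<close>

abbreviation cl :: "('a, 'b \<times> 'b) hom_term \<Rightarrow> ('a, 'b \<times> 'b) hom_term set" where
  "cl \<equiv> term_class star_relations"

lemma star_ops:
  "zero star_product = cl Zero"
  "add star_product (cl s) (cl t) = cl (Add s t)"
  "scl star_product c (cl t) = cl (Scale c t)"
  "twist star_product (cl t) = cl (Twist t)"
  "bracket star_product (cl s) (cl t) = cl (Bracket s t)"
  by (simp_all add: star_product_def presented_ops)

lemma cl_carrier [simp]: "cl t \<in> carrier star_product"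
  by (simp add: star_product_def)

lemma star_cases:
  assumes "x \<in> carrier star_product"
  obtains t where "x = cl t"
  using assms unfolding star_product_def by (rule presented_cases)

lemma star_carrier [simp]: "star m n \<in> carrier star_product"
  by (simp add: star_def)

sublocale S: hom_vector_space star_product
  unfolding star_product_def by (rule presented_hom_vector_space)

lemma star_simps:
  "star (m + m') n = add star_product (star m n) (star m' n)"
  "star m (n + n') = add star_product (star m n) (star m n')"
  "star (c *s m) n = scl star_product c (star m n)"
  "star m (c *s n) = scl star_product c (star m n)"
  "twist star_product (star m n) = star (\<alpha> m) (\<alpha> n)"
  "bracket star_product (star m n) (star m' n') = scl star_product (- 1) (star (br n m) (br m' n'))"
  "star (br m m') (\<alpha> n) =
    add star_product (star (\<alpha> m) (br m' n)) (scl star_product (- 1) (star (\<alpha> m') (br m n)))"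
  unfolding star_def star_ops term_class_eq_iff
  by (rule hom_lie_cong.rel, rule star_relations.intros)+

lemma bracket_closed:
  "\<lbrakk>x \<in> carrier star_product; y \<in> carrier star_product\<rbrakk> \<Longrightarrow> bracket star_product x y \<in> carrier star_product"
  by (elim star_cases) (simp add: star_ops)

lemma bracket_scl:
  assumes "x \<in> carrier star_product" "y \<in> carrier star_product"
  shows "bracket star_product (scl star_product c x) y = scl star_product c (bracket star_product x y)"
    and "bracket star_product x (scl star_product c y) = scl star_product c (bracket star_product x y)"
  using assms
  by (elim star_cases, simp add: star_ops term_class_eq_iff hom_lie_cong.bracket_scale_left
      hom_lie_cong.bracket_scale_right)+

lemma bracket_add:
  assumes "x \<in> carrier star_product" "y \<in> carrier star_product" "z \<in> carrier star_product"
  shows "bracket star_product (add star_product x y) z =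
      add star_product (bracket star_product x z) (bracket star_product y z)"
    and "bracket star_product z (add star_product x y) =
      add star_product (bracket star_product z x) (bracket star_product z y)"
  using assms
  by (elim star_cases, simp add: star_ops term_class_eq_iff hom_lie_cong.bracket_add_left
      hom_lie_cong.bracket_add_right)+

lemma bracket_zero:
  assumes "x \<in> carrier star_product"
  shows "bracket star_product (zero star_product) x = zero star_product"
    "bracket star_product x (zero star_product) = zero star_product"
  using bracket_scl[OF S.zero_closed assms, of 0] bracket_scl[OF assms S.zero_closed, of 0]
  by (simp_all add: S.scl_0 S.zero_closed bracket_closed assms)

lemma star_zero: "star 0 n = zero star_product"
  using star_simps(3)[of 0 0 n] by (simp add: S.scl_0)

lemma star_map_exists:
  "\<exists>h. h \<in> space_hom (tuple_space 2) star_product \<and> (\<forall>m n. h (pair m n) = star m n)"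
proof -
  have "(\<lambda>xs. star (xs ! 0) (xs ! 1)) \<in> {xs. length xs = 2} \<rightarrow> carrier star_product"
    by simp
  from S.free_extension[OF this, of "map \<alpha>"] obtain h where
    "h \<in> space_hom (free_space {xs. length xs = 2} (map \<alpha>)) star_product"
    "\<And>xs. length xs = 2 \<Longrightarrow> h (basis xs) = star (xs ! 0) (xs ! 1)"
    by (auto simp: star_simps)
  then show ?thesis
    by (intro exI[of _ h]) (simp add: tuple_space_def)
qed

text \<open>\<open>free_extension\<close> only asserts existence, hence the choice; on
  \<open>tuples 2\<close> the values are forced by those on pairs.\<close>

definition star_lift :: "('b list \<Rightarrow>\<^sub>0 'a) \<Rightarrow> ('a, 'b \<times> 'b) hom_term set" where
  "star_lift = (SOME h. h \<in> space_hom (tuple_space 2) star_product \<and> (\<forall>m n. h (pair m n) = star m n))"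

lemma star_lift_hom: "star_lift \<in> space_hom (tuple_space 2) star_product"
  and star_lift_pair: "star_lift (pair m n) = star m n"
  using someI_ex[OF star_map_exists] by (simp_all add: star_lift_def)

lemma star_lift_simps:
  "star_lift 0 = zero star_product"
  "f \<in> tuples 2 \<Longrightarrow> star_lift f \<in> carrier star_product"
  "\<lbrakk>f \<in> tuples 2; g \<in> tuples 2\<rbrakk> \<Longrightarrow> star_lift (f + g) = add star_product (star_lift f) (star_lift g)"
  "f \<in> tuples 2 \<Longrightarrow> star_lift (fscale c f) = scl star_product c (star_lift f)"
  "f \<in> tuples 2 \<Longrightarrow> star_lift (tuple_twist f) = twist star_product (star_lift f)"
  using tuple.space_hom_zero[OF S.hom_vector_space_axioms star_lift_hom] space_homD[OF star_lift_hom] by simp_all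

lemma pair_tuples: "pair m n \<in> tuples 2"
  by simp

lemma tuples_2_induct [consumes 1, case_names zero add scale basis]:
  assumes f: "f \<in> tuples 2" and "P 0"
    and "\<And>f g. \<lbrakk>f \<in> tuples 2; g \<in> tuples 2; P f; P g\<rbrakk> \<Longrightarrow> P (f + g)"
    and "\<And>c f. \<lbrakk>f \<in> tuples 2; P f\<rbrakk> \<Longrightarrow> P (fscale c f)"
    and "\<And>x y. P (pair x y)"
  shows "P f"
proof -
  have "linear_subspace (tuple_space 2) {f \<in> tuples 2. P f}"
    using assms(2-4)
    by (simp add: linear_subspace_def keys_add_subset keys_fscale_subset Collect_mono_iff)
  from tuples_2_least[OF this _ f] show ?thesis using assms(5) by simp
qed

text \<open>On generators the defining relation gives minus \<open>star (br n m) (br m' n')\<close>,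
  and skew-symmetry in \<open>L\<close> absorbs the sign. Bilinearity then extends the formula,
  first in the left argument and then in the right one. Brackets therefore stay in the linear span
  of the generators.\<close>

lemma bracket_star_lift:
  assumes f: "f \<in> tuples 2" and g: "g \<in> tuples 2"
  shows "bracket star_product (star_lift f) (star_lift g) = star (pair_br f) (pair_br g)"
proof -
  have neg: "scl star_product (- 1) (star (br n m) x) = star (br m n) x" for m n x
    using star_simps(3)[of "- 1" "br n m" x] by (simp add: br_skew[of m n])
  have pair: "bracket star_product (star_lift (pair m n)) (star_lift (pair m' n')) = star (br m n) (br m' n')" for m n m' n'
    by (simp add: star_lift_pair star_simps neg)
  have one: "bracket star_product (star_lift f) (star_lift (pair m n)) = star (pair_br f) (br m n)" for m n
    using f
  proof (induction rule: tuples_2_induct)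
    case (basis x y)
    show ?case by (simp add: pair pair_br_simps)
  qed (simp_all add: star_lift_simps pair_br_simps star_simps star_zero bracket_zero bracket_add bracket_scl star_lift_pair
      del: mem_Collect_eq)
  show ?thesis
    using g
  proof (induction rule: tuples_2_induct)
    case zero
    have "star x 0 = zero star_product" for x
      using star_simps(4)[of x 0 0] by (simp add: S.scl_0)
    then show ?case using f by (simp add: star_lift_simps pair_br_simps bracket_zero del: mem_Collect_eq)
  next
    case (basis x y)
    show ?case using one by (simp add: pair_br_simps)
  qed (use f in \<open>simp_all add: star_lift_simps pair_br_simps star_simps bracket_add bracket_scl del: mem_Collect_eq\<close>)
qed

text \<open>Evaluation of terms in representatives, with brackets computed as
  \<open>bracket_star_lift\<close> dictates. Compared with \<open>star_lift\<close> it shows that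
  the generators span; compared with the congruence it bounds the kernel.\<close>

primrec term_value :: "('a, 'b \<times> 'b) hom_term \<Rightarrow> ('b list \<Rightarrow>\<^sub>0 'a)" where
  "term_value (Gen p) = pair (fst p) (snd p)"
| "term_value Zero = 0"
| "term_value (Add s t) = term_value s + term_value t"
| "term_value (Scale c t) = fscale c (term_value t)"
| "term_value (Twist t) = tuple_twist (term_value t)"
| "term_value (Bracket s t) = pair (pair_br (term_value s)) (pair_br (term_value t))"

lemma term_value_tuples: "term_value t \<in> tuples 2"
proof (induction t)
  case (Twist t)
  then show ?case using tuple.twist_closed[of "term_value t" 2] by simp
qed (simp_all add: keys_add_subset keys_fscale_subset)

text \<open>Rewrites every term, with arbitrarily nested brackets and twists, as a linear
  combination of generators.\<close>

lemma star_lift_term_value: "star_lift (term_value t) = cl t"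
proof (induction t)
  case (Gen p)
  show ?case by (simp add: star_lift_pair star_def)
next
  case (Bracket s t)
  have "cl (Bracket s t) = bracket star_product (star_lift (term_value s)) (star_lift (term_value t))"
    by (simp add: Bracket star_ops)
  then show ?case by (simp add: bracket_star_lift[OF term_value_tuples term_value_tuples] star_lift_pair)
qed (simp_all add: star_lift_simps term_value_tuples star_ops del: mem_Collect_eq)

lemma star_lift_surj: "star_lift ` tuples 2 = carrier star_product"
proof (rule equalityI; rule subsetI)
  fix x assume "x \<in> carrier star_product"
  then obtain t where "x = cl t" by (rule star_cases)
  then have "x = star_lift (term_value t)" by (simp add: star_lift_term_value)
  then show "x \<in> star_lift ` tuples 2" by (rule image_eqI) (rule term_value_tuples)
qed (auto simp: star_lift_simps)

text \<open>The congruence speaks about terms only, so an element of the free space has to be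
  realised by one before the congruence can be applied to it.\<close>

lemma term_value_surj:
  assumes "f \<in> tuples 2"
  shows "\<exists>t. term_value t = f"
  using assms
proof (induction rule: tuples_2_induct)
  case zero
  show ?case using term_value.simps(2) by blast
next
  case (add f g)
  then show ?case using term_value.simps(3) by blast
next
  case (scale c f)
  then show ?case using term_value.simps(4) by blast
next
  case (basis x y)
  show ?case by (intro exI[of _ "Gen (x, y)"]) simp
qed

lemma pair_neg_right: "pair y (- x) + pair y x \<in> exterior_kernel 2"
  using pair_relations(4)[of y "- 1" x] by simp

text \<open>The Hom-Jacobi sum of \<open>m\<close>, \<open>m'\<close>, \<open>n\<close> after
  interchanging the factors of its last pair and the bracket in the second.\<close>

lemma pair_star_left: "pair (br m m') (\<alpha> n) - (pair (\<alpha> m) (br m' n) - pair (\<alpha> m') (br m n)) \<in> bounding"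
proof -
  have "pair (br m m') (\<alpha> n) - (pair (\<alpha> m) (br m' n) - pair (\<alpha> m') (br m n)) =
      (pair (br m m') (\<alpha> n) + pair (\<alpha> n) (br m m'))
      - (pair (\<alpha> m) (br m' n) + pair (\<alpha> m') (br n m) + pair (\<alpha> n) (br m m'))
      + (pair (\<alpha> m') (- br m n) + pair (\<alpha> m') (br m n))"
    by (simp add: br_skew[of n m])
  also have "\<dots> \<in> bounding"
    by (intro bounding_closed(2)[OF bounding_closed(5)[OF E_bounding[OF pair_skew] pair_jacobi] E_bounding[OF pair_neg_right]])
  finally show ?thesis .
qed

text \<open>The same for the triple \<open>m\<close>, \<open>n\<close>, \<open>n'\<close>, so modulo
  \<open>bounding\<close> the two relations express one identity.\<close>

lemma pair_star_right: "pair (\<alpha> m) (br n n') - (pair (br n' m) (\<alpha> n) - pair (br n m) (\<alpha> n')) \<in> bounding"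
proof -
  have "pair (\<alpha> m) (br n n') - (pair (br n' m) (\<alpha> n) - pair (br n m) (\<alpha> n')) =
      (pair (\<alpha> m) (br n n') + pair (\<alpha> n) (br n' m) + pair (\<alpha> n') (br m n))
      - (pair (\<alpha> n) (br n' m) + pair (br n' m) (\<alpha> n))
      - ((pair (\<alpha> n') (- br n m) + pair (\<alpha> n') (br n m)) - (pair (\<alpha> n') (br n m) + pair (br n m) (\<alpha> n')))"
    by (simp add: br_skew[of m n])
  also have "\<dots> \<in> bounding"
    by (intro bounding_closed(5)[OF bounding_closed(5)[OF pair_jacobi E_bounding[OF pair_skew]]
          E_bounding[OF E_closed(5)[OF pair_neg_right pair_skew]]])
  finally show ?thesis .
qed

lemma term_value_star_relations:
  assumes "(s, t) \<in> star_relations"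
  shows "term_value s - term_value t \<in> bounding"
  using assms
proof cases
  case (star_br_left m m' n)
  then show ?thesis using pair_star_left[of m m' n] by simp
next
  case (star_br_right m n n')
  then show ?thesis using pair_star_right[of m n n'] by simp
next
  case (star_bracket m n m' n')
  \<comment> \<open>By the value of a bracket, the two sides differ only in whether the sign stands
    inside the first entry or in front of the pair.\<close>
  then show ?thesis
    using E_bounding[OF pair_neg[of "br m n" "br m' n'"]] by (simp add: pair_br_simps br_skew[of n m] add.commute)
qed (use pair_relations in \<open>simp_all add: E_bounding fs.lift_simps bounding_closed(1) diff_diff_eq\<close>)

text \<open>
  The quotient of the free space on pairs by \<open>bounding\<close> is a Hom-Lie algebra under
  \<open>[f, g] = pair_br f \<and> pair_br g\<close>; its Hom-Jacobi identity is the vanishing of \<open>d\<^sub>3\<close>-boundaries.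
\<close>

lemma term_value_cong:
  assumes "hom_lie_cong star_relations s t"
  shows "term_value s - term_value t \<in> bounding"
  using assms
proof induction
  case (rel s t)
  then show ?case by (rule term_value_star_relations)
next
  case (sym s t)
  then show ?case using bounding_closed(4)[of "term_value s - term_value t"] by simp
next
  case (trans s t u)
  then show ?case using bounding_closed(2)[of "term_value s - term_value t" "term_value t - term_value u"] by simp
next
  case (cong_add s s' t t')
  then show ?case using bounding_closed(2)[of "term_value s - term_value s'" "term_value t - term_value t'"] by (simp add: add_diff_add)
next
  case (cong_scale t t' c)
  then show ?case using bounding_closed(3)[of "term_value t - term_value t'" c] by (simp add: fs.scale_right_diff_distrib)
next
  case (cong_twist t t')
  then show ?case using tuple_twist_bounding[of "term_value t - term_value t'"] by (simp add: fs.lift_simps)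
next
  case (cong_bracket s s' t t')
  \<comment> \<open>Replacing arguments by congruent ones leaves \<open>pair_br\<close> unchanged,
    so the two values are equal and not merely congruent.\<close>
  then have "pair_br (term_value s) = pair_br (term_value s')" "pair_br (term_value t) = pair_br (term_value t')"
    using pair_br_bounding[of "term_value s - term_value s'"] pair_br_bounding[of "term_value t - term_value t'"] by (simp_all add: pair_br_simps)
  then show ?case by (simp add: bounding_closed)
next
  case (skew s t)
  then show ?case using E_bounding[OF pair_skew] by simp
next
  case (hom_jacobi s t u)
  \<comment> \<open>An instance of \<open>pair_jacobi\<close> at the three \<open>pair_br\<close>
    values; \<open>pair_br_tuple_twist\<close> turns the twists of the terms into \<alpha>.\<close>
  then show ?case
    using pair_jacobi by (simp add: pair_br_simps pair_br_tuple_twist term_value_tuples add.assoc del: mem_Collect_eq)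
next
  case (twist_bracket s t)
  then show ?case
    by (simp add: fs.lift_simps pair_br_tuple_twist term_value_tuples bounding_closed del: mem_Collect_eq)
qed (use pair_relations in \<open>simp_all add: pair_br_simps fs.lift_simps E_bounding bounding_closed(1) diff_diff_eq ac_simps
    fs.scale_right_distrib fs.scale_left_distrib\<close>)


section \<open>The ideal of squares\<close>

lemma box_subspace: "linear_subspace star_product box_ideal"
  unfolding box_ideal_def by (rule S.linear_span_subspace) auto

lemma star_box: "star x x \<in> box_ideal"
  unfolding box_ideal_def by (rule linear_span_base) auto

lemma box_least:
  assumes "linear_subspace star_product U" "\<And>x. star x x \<in> U" "X \<in> box_ideal"
  shows "X \<in> U"
proof -
  have "{star x x | x. True} \<subseteq> U" using assms(2) by blast
  from linear_span_least[OF assms(1) this] show ?thesis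
    using assms(3) unfolding box_ideal_def by (rule subsetD)
qed

lemma twist_box:
  assumes "X \<in> box_ideal"
  shows "twist star_product X \<in> box_ideal"
proof -
  note box = linear_subspaceD[OF box_subspace]
  have "linear_subspace star_product {X \<in> carrier star_product. twist star_product X \<in> box_ideal}"
    using box(2-4) by (auto simp: linear_subspace_def S.zero_closed S.add_closed S.scl_closed
        S.twist_zero S.twist_add S.twist_scl)
  from box_least[OF this _ assms] show ?thesis by (simp add: star_simps star_box)
qed

sublocale box: twist_subspace star_product box_ideal
  by standard (auto simp: box_subspace twist_box)

text \<open>By \<open>bracket_star_lift\<close> a bracket sees its arguments only through
  \<open>pair_br\<close>, and a square contributes \<open>br x x = 0\<close>. Centrality lets the
  bracket descend to the quotient.\<close>

lemma box_central:
  assumes "X \<in> box_ideal" "Y \<in> carrier star_product"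
  shows "bracket star_product X Y = zero star_product"
    and "bracket star_product Y X = zero star_product"
proof -
  obtain g where g: "g \<in> tuples 2" "Y = star_lift g"
    using assms(2) unfolding star_lift_surj[symmetric] by (elim imageE)
  have "star y 0 = zero star_product" for y
    using star_simps(4)[of y 0 0] by (simp add: S.scl_0)
  then have gen: "bracket star_product (star x x) Y = zero star_product"
    "bracket star_product Y (star x x) = zero star_product" for x
    using bracket_star_lift[OF pair_tuples g(1), of x x] bracket_star_lift[OF g(1) pair_tuples, of x x]
    by (simp_all add: g(2) star_lift_pair pair_br_simps br_alt star_zero)
  have "linear_subspace star_product {X \<in> carrier star_product.
      bracket star_product X Y = zero star_product \<and> bracket star_product Y X = zero star_product}"
    using assms(2) by (auto simp: linear_subspace_def S.zero_closed S.add_closed S.scl_closed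
        bracket_zero bracket_add bracket_scl S.add_zero S.scl_zero)
  from box_least[OF this _ assms(1)] show "bracket star_product X Y = zero star_product"
    "bracket star_product Y X = zero star_product"
    by (simp_all add: gen)
qed

section \<open>The quotient by squares and its presentation by pairs\<close>

lemma quotient_algebra_simps:
  "carrier (quotient_algebra A I) = carrier (quotient_space A I)"
  "zero (quotient_algebra A I) = zero (quotient_space A I)"
  "add (quotient_algebra A I) = add (quotient_space A I)"
  "scl (quotient_algebra A I) = scl (quotient_space A I)"
  "twist (quotient_algebra A I) = twist (quotient_space A I)"
  "bracket (quotient_algebra A I) X Y = (\<Union>x\<in>X. \<Union>y\<in>Y. coset A I (bracket A x y))"
  by (simp_all add: quotient_algebra_def hom_space.defs hom_algebra.defs)

abbreviation q :: "('a, 'b \<times> 'b) hom_term set \<Rightarrow> ('a, 'b \<times> 'b) hom_term set set" where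
  "q \<equiv> coset star_product box_ideal"

lemma q_hom: "q \<in> space_hom star_product curly_product"
  using box.coset_space_hom
  by (simp add: space_hom_def curly_product_def quotient_algebra_simps)

lemma q_image: "q ` carrier star_product = carrier curly_product"
  by (simp add: curly_product_def quotient_algebra_simps box.coset_image)

lemma q_zero: "q (zero star_product) = zero curly_product"
  by (simp add: curly_product_def quotient_algebra_simps box.coset_zero)

lemma q_bracket:
  assumes "X \<in> carrier star_product" "Y \<in> carrier star_product"
  shows "bracket curly_product (q X) (q Y) = q (bracket star_product X Y)"
  unfolding curly_product_def quotient_algebra_simps
proof (intro UN_const[OF box.coset_self[OF assms(1)]] UN_const[OF box.coset_self[OF assms(2)]])
  fix X' Y' assume "X' \<in> q X" "Y' \<in> q Y"
  then obtain u v where uv: "u \<in> box_ideal" "v \<in> box_ideal"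
    and "X' = add star_product X u" "Y' = add star_product Y v"
    by (auto simp: coset_def)
  then have "bracket star_product X' Y' = bracket star_product X Y"
    using assms box.U_carrier
    by (simp add: bracket_add S.add_closed box_central bracket_closed S.add_zero S.add_zero_right S.zero_closed)
  then show "q (bracket star_product X' Y') = q (bracket star_product X Y)" by simp
qed

definition curly_lift :: "('b list \<Rightarrow>\<^sub>0 'a) \<Rightarrow> ('a, 'b \<times> 'b) hom_term set set" where
  "curly_lift = (\<lambda>f. q (star_lift f))"

lemma curly_lift_hom: "curly_lift \<in> space_hom (tuple_space 2) curly_product"
  using space_hom_compose[OF star_lift_hom q_hom] unfolding curly_lift_def comp_def .

lemma curly_lift_image: "curly_lift ` tuples 2 = carrier curly_product"
  unfolding curly_lift_def q_image[symmetric] star_lift_surj[symmetric] image_image ..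

lemma curly_lift_zero: "curly_lift 0 = zero curly_product"
  by (simp add: curly_lift_def star_lift_simps q_zero)

lemma curly_lift_pair: "curly_lift (pair m n) = curly m n"
  by (simp add: curly_lift_def star_lift_pair curly_def)

lemma curly_lift_bracket:
  assumes "f \<in> tuples 2" "g \<in> tuples 2"
  shows "bracket curly_product (curly_lift f) (curly_lift g) = curly (pair_br f) (pair_br g)"
  by (simp add: curly_lift_def q_bracket star_lift_simps assms bracket_star_lift curly_def del: mem_Collect_eq)

sublocale curly: hom_vector_space curly_product
  by (rule S.image_hom_vector_space[OF q_hom q_image q_zero])

lemma curly_lift_eq_zero_iff_box: "f \<in> tuples 2 \<Longrightarrow> curly_lift f = zero curly_product \<longleftrightarrow> star_lift f \<in> box_ideal"
  using box.coset_eq_zero_iff[of "star_lift f"] by (simp add: curly_lift_def q_zero star_lift_simps del: mem_Collect_eq)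

text \<open>The upper bound on the kernel. Classes with a representing term of value in
  \<open>bounding\<close> form a subspace that contains the squares, hence the whole ideal;
  \<open>term_value_cong\<close> carries the conclusion to any term with value
  \<open>f\<close>.\<close>

lemma bounding_if_box:
  assumes f: "f \<in> tuples 2" and box: "star_lift f \<in> box_ideal"
  shows "f \<in> bounding"
proof -
  \<comment> \<open>Asking for some good representative keeps the closure proofs free of
    well-definedness; the congruence is invoked just once, at the end.\<close>
  let ?U = "{X. \<exists>t. X = cl t \<and> term_value t \<in> bounding}"
  have "linear_subspace star_product ?U"
    unfolding linear_subspace_def
  proof (intro conjI ballI allI)
    show "zero star_product \<in> ?U"
      by (auto simp: star_ops bounding_closed(1) intro!: exI[of _ Zero])
    fix X assume "X \<in> ?U"
    then obtain s where s: "X = cl s" "term_value s \<in> bounding" by blast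
    show "scl star_product c X \<in> ?U" for c
      using s by (auto simp: star_ops bounding_closed(3) intro!: exI[of _ "Scale c s"])
    fix Y assume "Y \<in> ?U"
    then obtain t where "Y = cl t" "term_value t \<in> bounding" by blast
    with s show "add star_product X Y \<in> ?U"
      by (auto simp: star_ops bounding_closed(2) intro!: exI[of _ "Add s t"])
  qed auto
  moreover have "star x x \<in> ?U" for x
    by (auto simp: star_def E_bounding pair_relations intro!: exI[of _ "Gen (x, x)"])
  ultimately obtain t where t: "star_lift f = cl t" "term_value t \<in> bounding"
    using box_least[OF _ _ box, of ?U] by blast
  obtain s where s: "term_value s = f" using term_value_surj[OF f] ..
  then have "cl s = cl t" using t(1) star_lift_term_value by metis
  then have "term_value s - term_value t \<in> bounding" by (simp add: term_class_eq_iff term_value_cong)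
  from bounding_closed(2)[OF this t(2)] show ?thesis by (simp add: s)
qed

lemma curly_lift_diff_zero:
  assumes "f \<in> tuples 2" "g \<in> tuples 2" "star_lift f = star_lift g"
  shows "curly_lift (f - g) = zero curly_product"
  using tuple.space_hom_eq_iff[OF curly.hom_vector_space_axioms curly_lift_hom, of f g] assms
  by (simp add: curly_lift_def)

text \<open>The lower bound on the kernel. It contains the bilinear relations because they hold for
  \<open>star\<close>, the alternating ones because squares are divided out, and the boundaries
  because of the relation for a bracket in the left factor.\<close>

lemma curly_lift_bounding:
  assumes "f \<in> bounding"
  shows "curly_lift f = zero curly_product"
proof -
  let ?K = "{f \<in> tuples 2. curly_lift f = zero curly_product}"
  have K: "linear_subspace (tuple_space 2) ?K"
    using tuple.kernel_subspace[OF curly.hom_vector_space_axioms curly_lift_hom] by (simp add: kernel_def)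
  note K_closed = subspace_closed[OF K]
  have diff: "f - g \<in> ?K" if "f \<in> tuples 2" "g \<in> tuples 2" "star_lift f = star_lift g" for f g
    using curly_lift_diff_zero[OF that] tuples_closed(5)[OF that(1,2)] by simp
  have rel:
    "pair (x + y) z - (pair x z + pair y z) \<in> ?K" "pair z (x + y) - (pair z x + pair z y) \<in> ?K"
    "pair (c *s x) z - fscale c (pair x z) \<in> ?K" "pair z (c *s x) - fscale c (pair z x) \<in> ?K"
    for x y z c
    by (intro diff; simp add: keys_add_subset keys_fscale_subset star_lift_simps star_lift_pair star_simps)+
  have alt: "pair x x \<in> ?K" for x
    using curly_lift_eq_zero_iff_box[OF pair_tuples, of x x] by (simp add: star_lift_pair star_box)
  have rels: "exterior_relations 2 \<subseteq> ?K"
  proof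
    fix f assume "f \<in> exterior_relations 2"
    then show "f \<in> ?K"
    proof cases
      case (multi_add xs i x y)
      then obtain a b where xs: "xs = [a, b]" and i: "i = 0 \<or> i = 1"
        by (auto simp: length_2_iff less_2_iff)
      have "f = pair (x + y) b - (pair x b + pair y b) \<or> f = pair a (x + y) - (pair a x + pair a y)"
        using i unfolding multi_add xs by (auto simp: diff_diff_eq)
      then show ?thesis by (elim disjE) (simp_all only: rel)
    next
      case (multi_scale xs i c x)
      then obtain a b where xs: "xs = [a, b]" and i: "i = 0 \<or> i = 1"
        by (auto simp: length_2_iff less_2_iff)
      have "f = pair (c *s x) b - fscale c (pair x b) \<or> f = pair a (c *s x) - fscale c (pair a x)"
        using i unfolding multi_scale xs by auto
      then show ?thesis by (elim disjE) (simp_all only: rel)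
    next
      case (alternating xs i j)
      then have "\<exists>a. f = pair a a" by (auto simp: length_2_iff less_2_iff)
      then show ?thesis by (elim exE) (simp only: alt)
    qed
  qed
  have E: "f \<in> ?K" if "f \<in> exterior_kernel 2" for f
    by (rule E_least[OF K rels that])
  have tuple_boundary: "tuple_boundary (basis [x, y, z]) \<in> ?K" for x y z
  proof -
    have c: "fscale (- 1) (pair (\<alpha> y) (br x z)) \<in> tuples 2"
      by (rule tuples_closed(3)[OF pair_tuples])
    \<comment> \<open>Up to two uses of skew-symmetry this is minus the relation
      \<open>star_simps(7)\<close> for \<open>x\<close>, \<open>y\<close>, \<open>z\<close>. The
      scalar -1 is kept explicit to match that relation, as \<open>star_product\<close> has no
      subtraction.\<close>
    have "tuple_boundary (basis [x, y, z]) =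
        (pair (\<alpha> y) (br x z) + pair (br x z) (\<alpha> y)) - (pair (\<alpha> x) (br y z) + pair (br y z) (\<alpha> x))
        - (pair (br x y) (\<alpha> z) - (pair (\<alpha> x) (br y z) + fscale (- 1) (pair (\<alpha> y) (br x z))))"
      by (simp add: fs.lift_simps boundary_tuple_3)
    also have "\<dots> \<in> ?K"
      by (rule K_closed(5)[OF K_closed(5)[OF E[OF pair_skew] E[OF pair_skew]] diff[OF pair_tuples tuples_closed(2)[OF pair_tuples c]]])
        (simp only: star_lift_simps(3)[OF pair_tuples c] star_lift_simps(4)[OF pair_tuples] star_lift_pair star_simps(7))
    finally show ?thesis .
  qed
  have tuple_boundary_sub: "linear_subspace (tuple_space 3) {g \<in> tuples 3. tuple_boundary g \<in> ?K}"
    using lift_vimage_subspace[OF K[unfolded tuple_space_def]] by (simp add: tuple_space_def)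
  have bd3: "tuple_boundary g \<in> ?K" if "g \<in> tuples 3" for g
  proof -
    have "basis [x, y, z] \<in> {g \<in> tuples 3. tuple_boundary g \<in> ?K}" for x y z
      by (rule CollectI) (rule conjI[OF _ tuple_boundary], simp)
    from tuples_3_least[OF tuple_boundary_sub this that] show ?thesis by (elim CollectE[of g] conjE)
  qed
  obtain g where g: "g \<in> tuples 3" "f - tuple_boundary g \<in> exterior_kernel 2"
    using assms by (rule bounding_E)
  from K_closed(2)[OF E[OF g(2)] bd3[OF g(1)]] show ?thesis by simp
qed

lemma curly_lift_eq_zero_iff: "f \<in> tuples 2 \<Longrightarrow> curly_lift f = zero curly_product \<longleftrightarrow> f \<in> bounding"
  by (rule iffI, rule bounding_if_box, assumption, simp only: curly_lift_eq_zero_iff_box, rule curly_lift_bounding)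

text \<open>Well-definedness of the commutator map, deduced from the exact kernel of
  \<open>curly_lift\<close>.\<close>

lemma curly_lift_eq_imp_lam_eq:
  assumes "f \<in> tuples 2" "g \<in> tuples 2" "curly_lift f = curly_lift g"
  shows "pair_br f = pair_br g"
proof -
  have "f - g \<in> bounding"
    using tuple.space_hom_eq_iff[OF curly.hom_vector_space_axioms curly_lift_hom, of f g] assms
      curly_lift_eq_zero_iff[OF tuples_closed(5)[OF assms(1,2)]] by simp
  from pair_br_bounding[OF this] show ?thesis by (simp add: pair_br_simps)
qed


section \<open>The commutator map\<close>

lemma self_algebra_simps [simp]:
  "carrier self_algebra = UNIV" "zero self_algebra = 0" "add self_algebra = (+)"
  "scl self_algebra = scale" "twist self_algebra = \<alpha>" "bracket self_algebra = br"
  by (simp_all add: self_algebra_def)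

lemma curly_cases:
  assumes "X \<in> carrier curly_product"
  obtains f where "f \<in> tuples 2" "X = curly_lift f"
  using assms unfolding curly_lift_image[symmetric] by (elim imageE) (rule that)

lemma commutator_map_pH:
  assumes "f \<in> tuples 2"
  shows "commutator_map (curly_lift f) = pair_br f"
proof -
  \<comment> \<open>Any representative serves, by the preceding lemma. Restriction to the carrier
    meets the extensionality demanded by the definite description, which needs both existence and
    uniqueness.\<close>
  define c where "c = restrict (\<lambda>X. pair_br (SOME f. f \<in> tuples 2 \<and> curly_lift f = X)) (carrier curly_product)"
  have curly_lift_carrier: "curly_lift f \<in> carrier curly_product" if "f \<in> tuples 2" for f
    using imageI[OF that, of curly_lift] by (simp only: curly_lift_image)
  have c: "c (curly_lift f) = pair_br f" if f: "f \<in> tuples 2" for f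
  proof -
    have "(SOME g. g \<in> tuples 2 \<and> curly_lift g = curly_lift f) \<in> tuples 2 \<and>
        curly_lift (SOME g. g \<in> tuples 2 \<and> curly_lift g = curly_lift f) = curly_lift f"
      by (rule someI[of _ f]) (use f in blast)
    then show ?thesis
      using curly_lift_eq_imp_lam_eq[OF _ f] curly_lift_carrier[OF f] unfolding c_def by simp
  qed
  have ops: "c (add curly_product X Y) = c X + c Y" "c (scl curly_product k X) = k *s c X"
    "c (twist curly_product X) = \<alpha> (c X)" "c (bracket curly_product X Y) = br (c X) (c Y)"
    if XY: "X \<in> carrier curly_product" "Y \<in> carrier curly_product" for X Y k
  proof -
    obtain f g where f: "f \<in> tuples 2" "X = curly_lift f" and g: "g \<in> tuples 2" "Y = curly_lift g"
      using XY by (elim curly_cases)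
    note curly_lift_ops = space_homD(2-4)[OF curly_lift_hom, unfolded tuple_space_simps, OF f(1)]
    have "c (add curly_product (curly_lift f) (curly_lift g)) = c (curly_lift f) + c (curly_lift g)"
      by (simp only: curly_lift_ops(1)[OF g(1), symmetric] c f(1) g(1) tuples_closed(2) pair_br_simps)
    moreover have "c (scl curly_product k (curly_lift f)) = k *s c (curly_lift f)"
      by (simp only: curly_lift_ops(2)[symmetric] c f(1) tuples_closed(3) pair_br_simps)
    moreover have "c (twist curly_product (curly_lift f)) = \<alpha> (c (curly_lift f))"
      using tuple_twist_tuples[OF f(1)] by (simp only: curly_lift_ops(3)[symmetric] c f(1) pair_br_tuple_twist)
    moreover have "c (bracket curly_product (curly_lift f) (curly_lift g)) = br (c (curly_lift f)) (c (curly_lift g))"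
      by (simp only: curly_lift_bracket f(1) g(1) curly_lift_pair[symmetric] c pair_tuples pair_br_simps)
    ultimately show "c (add curly_product X Y) = c X + c Y" "c (scl curly_product k X) = k *s c X"
      "c (twist curly_product X) = \<alpha> (c X)" "c (bracket curly_product X Y) = br (c X) (c Y)"
      by (simp_all only: f(2) g(2))
  qed
  have "commutator_map = c"
    unfolding commutator_map_def
  proof (rule the_equality, intro conjI allI)
    show "c \<in> algebra_hom curly_product self_algebra"
      by (simp add: algebra_hom_def space_hom_def ops)
    show "c \<in> extensional (carrier curly_product)" by (simp add: c_def)
    show "c (curly m n) = br m n" for m n
      using c[OF pair_tuples, of m n] by (simp add: curly_lift_pair pair_br_simps)
  next
    fix d assume d: "d \<in> algebra_hom curly_product self_algebra \<and>
      d \<in> extensional (carrier curly_product) \<and> (\<forall>m n. d (curly m n) = br m n)"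
    then have dh: "d \<in> space_hom curly_product self_algebra" by (simp add: algebra_hom_def)
    have dz: "d (zero curly_product) = 0"
      using space_homD(3)[OF dh curly.zero_closed, of 0] by (simp add: curly.scl_zero)
    \<comment> \<open>Uniqueness: a linear map with prescribed values on generators is determined,
      since every element of the carrier is some \<open>curly_lift f\<close>.\<close>
    have dp: "d (curly_lift f) = pair_br f" if "f \<in> tuples 2" for f
      using that
    proof (induction rule: tuples_2_induct)
      case (add f g)
      then show ?case
        using space_homD(2)[OF dh curly_lift_carrier curly_lift_carrier, of f g] space_homD(2)[OF curly_lift_hom, of f g]
        by (simp add: pair_br_simps)
    next
      case (scale k f)
      then show ?case
        using space_homD(3)[OF dh curly_lift_carrier, of f k] space_homD(3)[OF curly_lift_hom, of f k]
        by (simp add: pair_br_simps)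
    qed (use d dz in \<open>simp_all add: curly_lift_zero pair_br_simps curly_lift_pair\<close>)
    show "d = c"
    proof (rule extensionalityI[of d "carrier curly_product" c])
      show "d \<in> extensional (carrier curly_product)" using d by blast
      show "c \<in> extensional (carrier curly_product)" by (simp add: c_def)
      show "d X = c X" if "X \<in> carrier curly_product" for X
        using that by (rule curly_cases) (simp only: dp c)
    qed
  qed
  then show ?thesis using c[OF assms] by simp
qed

lemma commutator_kernel_hom:
  "curly_lift \<in> space_hom cycle_space commutator_kernel" "curly_lift ` carrier cycle_space = carrier commutator_kernel"
  "curly_lift (zero cycle_space) = zero commutator_kernel"
  "f \<in> carrier cycle_space \<Longrightarrow> curly_lift f = zero commutator_kernel \<longleftrightarrow> f \<in> bounding"
proof -
  have "kernel curly_product self_algebra commutator_map = curly_lift ` {f \<in> tuples 2. pair_br f = 0}"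
    unfolding kernel_def self_algebra_simps curly_lift_image[symmetric]
    by (rule equalityI; rule subsetI) (elim CollectE conjE imageE, simp add: commutator_map_pH)+
  note ker = this
  show "curly_lift \<in> space_hom cycle_space commutator_kernel"
    unfolding cycle_space_def commutator_kernel_def ker by (rule space_hom_restrict[OF curly_lift_hom]) auto
  show "curly_lift ` carrier cycle_space = carrier commutator_kernel" "curly_lift (zero cycle_space) = zero commutator_kernel"
    "f \<in> carrier cycle_space \<Longrightarrow> curly_lift f = zero commutator_kernel \<longleftrightarrow> f \<in> bounding"
    using curly_lift_eq_zero_iff[of f] by (simp_all add: cycle_space_def commutator_kernel_def restrict_space_def ker curly_lift_zero)
qed

lemma homology_isomorphic_commutator_kernel: "space_isomorphic (homology 2) commutator_kernel"
proof -
  obtain k where k: "k \<in> space_hom cycle_space (homology 2)" "k ` carrier cycle_space = carrier (homology 2)"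
    "k (zero cycle_space) = zero (homology 2)" "\<And>f. f \<in> carrier cycle_space \<Longrightarrow> k f = zero (homology 2) \<longleftrightarrow> f \<in> bounding"
    by (rule homology_hom) blast
  show ?thesis
    by (rule space_isomorphic_if_same_kernel[OF cycle_space_hom_vector_space k(1-3) commutator_kernel_hom(1-3)])
      (simp add: k(4) commutator_kernel_hom(4))
qed

end

theorem theorem4p1:
  fixes scale :: "'k::field \<Rightarrow> 'v::ab_group_add \<Rightarrow> 'v"
    and \<alpha> :: "'v \<Rightarrow> 'v"
    and br :: "'v \<Rightarrow> 'v \<Rightarrow> 'v"
  assumes "hom_lie_algebra scale \<alpha> br"
    and "(2 :: 'k) = 0 \<Longrightarrow> \<forall>x. br x x = 0"
  shows "space_isomorphic (hom_lie_algebra.homology scale \<alpha> br 2)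
           (hom_lie_algebra.commutator_kernel scale \<alpha> br)"
proof -
  interpret hom_lie_algebra scale \<alpha> br by fact
  interpret alternating_hom_lie scale \<alpha> br
    by standard (use assms(2) br_self in blast)
  show ?thesis by (rule homology_isomorphic_commutator_kernel)
qed

end
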